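(* Let $G$ be a hyperbolic group and suppose that $G$ admits a uniform quasimorphism. Then there is a zipper $Z^\pm\subset\partial_\infty G$ for $G$.
   Context: A zipper for a hyperbolic group $G$ with Gromov boundary $\partial_\infty G$ is a pair $Z^\pm$ of nonempty, path-connected, disjoint, $G$-invariant subsets of $\partial_\infty G$. A function $\psi:G\to\mathbb{R}$ is a quasimorphism if there is some least real constant $D(\psi)\ge 0$ (the defect) such that $|\psi(gh)-\psi(g)-\psi(h)|\le D(\psi)$ for all $g,h\in G$. Fix a finite symmetric generating set $S$ of $G$ and let $d$ be the induced word metric on $G$. For $X\subset G$, a $C$-chain in $X$ is a sequence $x_0,x_1,\dots,x_n$ of elements of $X$ with $d(x_i,x_{i+1})\le C$ for all $i$. $X$ is $C$-connected (for an integer $C>0$) if any two elements of $X$ may be joined by a $C$-chain in $X$. For a nondecreasing function $f:\mathbb{N}\to\mathbb{N}$, $X$ is $(C,f)$-connected if it is $C$-connected and, for all positive integers $m$ and all $x,y\in X$ with $d(x,y)\le m$, there is a $C$-chain in $X$ from $x$ to $y$ of length at most $f(m)$. Let $C>0$ be an integer and $f:\mathbb{N}\to\mathbb{N}$ a nondecreasing function. A quasimorphism $\phi:G\to\mathbb{Z}$ is $(C,f)$-uniform if (1) $D(\phi)\le 1$; (2) for any $g\in G$ there are $h^+,h^-\in G$ with $d(g,h^\pm)\le C$ and $\phi(h^\pm)-\phi(g)=\pm1$; and (3) for any integer $n$, the level set $\phi^{-1}(n)$ is $(C,f)$-connected. It is uniform if it is $(C,f)$-uniform for some $(C,f)$.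 *)

theory Defs
  imports "HOL-Analysis.Analysis" "HOL-Algebra.Generated_Groups"
begin

section \<open>Word metrics\<close>

definition finite_symmetric_generating_set :: "('a, 'b) monoid_scheme \<Rightarrow> 'a set \<Rightarrow> bool" where
  "finite_symmetric_generating_set G S \<longleftrightarrow>
     finite S \<and> S \<subseteq> carrier G \<and> (\<forall>s\<in>S. inv\<^bsub>G\<^esub> s \<in> S) \<and> generate G S = carrier G"

definition word_length :: "('a, 'b) monoid_scheme \<Rightarrow> 'a set \<Rightarrow> 'a \<Rightarrow> nat" where
  "word_length G S g =
     (LEAST n. \<exists>ws. set ws \<subseteq> S \<and> length ws = n \<and> foldr (\<otimes>\<^bsub>G\<^esub>) ws \<one>\<^bsub>G\<^esub> = g)"

definition word_dist :: "('a, 'b) monoid_scheme \<Rightarrow> 'a set \<Rightarrow> 'a \<Rightarrow> 'a \<Rightarrow> nat" where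
  "word_dist G S g h = word_length G S (inv\<^bsub>G\<^esub> g \<otimes>\<^bsub>G\<^esub> h)"

section \<open>Hyperbolic groups\<close>

definition gromov_product :: "('a, 'b) monoid_scheme \<Rightarrow> 'a set \<Rightarrow> 'a \<Rightarrow> 'a \<Rightarrow> 'a \<Rightarrow> real" where
  "gromov_product G S p x y =
     (real (word_dist G S p x) + real (word_dist G S p y) - real (word_dist G S x y)) / 2"

text \<open>
  Gromov's four-point condition for the word metric of \<open>S\<close>. Hyperbolicity is stated relative to
  the fixed generating set; for finite generating sets of a group it does not depend on the choice.
\<close>

definition hyperbolic_group :: "('a, 'b) monoid_scheme \<Rightarrow> 'a set \<Rightarrow> bool" where
  "hyperbolic_group G S \<longleftrightarrow>
     group G \<and> finite_symmetric_generating_set G S \<and>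
     (\<exists>\<delta>\<ge>0. \<forall>p\<in>carrier G. \<forall>x\<in>carrier G. \<forall>y\<in>carrier G. \<forall>z\<in>carrier G.
        gromov_product G S p x z
          \<ge> min (gromov_product G S p x y) (gromov_product G S p y z) - \<delta>)"

section \<open>The Gromov boundary\<close>

text \<open>
  The boundary is the set of equivalence classes of sequences that converge at infinity, that is,
  whose Gromov products \<open>(x\<^sub>i | x\<^sub>j)\<close>, based at the identity, tend to infinity with
  \<open>i\<close> and \<open>j\<close>.
\<close>

definition gromov_sequences :: "('a, 'b) monoid_scheme \<Rightarrow> 'a set \<Rightarrow> (nat \<Rightarrow> 'a) set" where
  "gromov_sequences G S =
     {x. range x \<subseteq> carrier G \<and>
         filterlim (\<lambda>(i, j). gromov_product G S \<one>\<^bsub>G\<^esub> (x i) (x j)) at_top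
           (sequentially \<times>\<^sub>F sequentially)}"

definition gromov_equiv ::
  "('a, 'b) monoid_scheme \<Rightarrow> 'a set \<Rightarrow> ((nat \<Rightarrow> 'a) \<times> (nat \<Rightarrow> 'a)) set" where
  "gromov_equiv G S =
     {(x, y). x \<in> gromov_sequences G S \<and> y \<in> gromov_sequences G S \<and>
        filterlim (\<lambda>(i, j). gromov_product G S \<one>\<^bsub>G\<^esub> (x i) (y j)) at_top
          (sequentially \<times>\<^sub>F sequentially)}"

definition gromov_boundary :: "('a, 'b) monoid_scheme \<Rightarrow> 'a set \<Rightarrow> (nat \<Rightarrow> 'a) set set" where
  "gromov_boundary G S = gromov_sequences G S // gromov_equiv G S"

definition boundary_nbhd ::
  "('a, 'b) monoid_scheme \<Rightarrow> 'a set \<Rightarrow> (nat \<Rightarrow> 'a) set \<Rightarrow> real \<Rightarrow> (nat \<Rightarrow> 'a) set set" where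
  "boundary_nbhd G S \<xi> r =
     {\<eta> \<in> gromov_boundary G S. \<exists>x\<in>\<xi>. \<exists>y\<in>\<eta>.
        ereal r \<le> Liminf (sequentially \<times>\<^sub>F sequentially)
                    (\<lambda>(i, j). ereal (gromov_product G S \<one>\<^bsub>G\<^esub> (x i) (y j)))}"

text \<open>
  In a hyperbolic group the sets \<open>boundary_nbhd G S \<xi> r\<close>, for real \<open>r\<close>, form a basis of (not
  necessarily open) neighbourhoods of \<open>\<xi>\<close>; the topology they determine is the one below.
\<close>

definition boundary_topology ::
  "('a, 'b) monoid_scheme \<Rightarrow> 'a set \<Rightarrow> (nat \<Rightarrow> 'a) set topology" where
  "boundary_topology G S =
     topology (\<lambda>U. U \<subseteq> gromov_boundary G S \<and> (\<forall>\<xi>\<in>U. \<exists>r. boundary_nbhd G S \<xi> r \<subseteq> U))"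

lemma boundary_nbhd_antimono: "r \<le> s \<Longrightarrow> boundary_nbhd G S \<xi> s \<subseteq> boundary_nbhd G S \<xi> r"
  unfolding boundary_nbhd_def by (smt (verit, best) Collect_mono ereal_less_eq(3) order_trans)

lemma openin_boundary_topology:
  "openin (boundary_topology G S) U \<longleftrightarrow>
     U \<subseteq> gromov_boundary G S \<and> (\<forall>\<xi>\<in>U. \<exists>r. boundary_nbhd G S \<xi> r \<subseteq> U)"
proof -
  let ?P = "\<lambda>U. U \<subseteq> gromov_boundary G S \<and> (\<forall>\<xi>\<in>U. \<exists>r. boundary_nbhd G S \<xi> r \<subseteq> U)"
  have "?P (U \<inter> V)" if U: "?P U" and V: "?P V" for U V
  proof (intro conjI ballI)
    show "U \<inter> V \<subseteq> gromov_boundary G S" using U by blast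
  next
    fix \<xi> assume "\<xi> \<in> U \<inter> V"
    then obtain r s where "boundary_nbhd G S \<xi> r \<subseteq> U" "boundary_nbhd G S \<xi> s \<subseteq> V"
      using U V by blast
    then have "boundary_nbhd G S \<xi> (max r s) \<subseteq> U \<inter> V"
      using boundary_nbhd_antimono[of r "max r s"] boundary_nbhd_antimono[of s "max r s"]
      by (metis Int_greatest max.cobounded1 max.cobounded2 subset_trans)
    then show "\<exists>r. boundary_nbhd G S \<xi> r \<subseteq> U \<inter> V" ..
  qed
  moreover have "?P (\<Union>\<U>)" if "\<forall>U\<in>\<U>. ?P U" for \<U>
    using that by (meson Sup_least Union_iff Union_upper subset_trans)
  ultimately have "istopology ?P"
    unfolding istopology_def by blast
  then show ?thesis
    unfolding boundary_topology_def by (simp add: topology_inverse')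
qed

lemma topspace_boundary_topology: "topspace (boundary_topology G S) = gromov_boundary G S"
proof -
  have "openin (boundary_topology G S) (gromov_boundary G S)"
    by (auto simp: openin_boundary_topology boundary_nbhd_def)
  then show ?thesis
    by (metis openin_boundary_topology openin_subset openin_topspace subset_antisym)
qed

definition boundary_act ::
  "('a, 'b) monoid_scheme \<Rightarrow> 'a \<Rightarrow> (nat \<Rightarrow> 'a) set \<Rightarrow> (nat \<Rightarrow> 'a) set" where
  "boundary_act G g \<xi> = (\<lambda>x n. g \<otimes>\<^bsub>G\<^esub> x n) ` \<xi>"

section \<open>Zippers\<close>

definition zipper ::
  "('a, 'b) monoid_scheme \<Rightarrow> 'a set \<Rightarrow> (nat \<Rightarrow> 'a) set set \<Rightarrow> (nat \<Rightarrow> 'a) set set \<Rightarrow> bool" where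
  "zipper G S Zp Zm \<longleftrightarrow>
     Zp \<subseteq> gromov_boundary G S \<and> Zm \<subseteq> gromov_boundary G S \<and>
     Zp \<noteq> {} \<and> Zm \<noteq> {} \<and>
     path_connectedin (boundary_topology G S) Zp \<and>
     path_connectedin (boundary_topology G S) Zm \<and>
     Zp \<inter> Zm = {} \<and>
     (\<forall>g\<in>carrier G. boundary_act G g ` Zp = Zp \<and> boundary_act G g ` Zm = Zm)"

section \<open>Uniform quasimorphisms\<close>

definition quasimorphism :: "('a, 'b) monoid_scheme \<Rightarrow> ('a \<Rightarrow> real) \<Rightarrow> bool" where
  "quasimorphism G \<psi> \<longleftrightarrow>
     (\<exists>D\<ge>0. \<forall>g\<in>carrier G. \<forall>h\<in>carrier G. \<bar>\<psi> (g \<otimes>\<^bsub>G\<^esub> h) - \<psi> g - \<psi> h\<bar> \<le> D)"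

definition defect :: "('a, 'b) monoid_scheme \<Rightarrow> ('a \<Rightarrow> real) \<Rightarrow> real" where
  "defect G \<psi> =
     (LEAST D. D \<ge> 0 \<and> (\<forall>g\<in>carrier G. \<forall>h\<in>carrier G. \<bar>\<psi> (g \<otimes>\<^bsub>G\<^esub> h) - \<psi> g - \<psi> h\<bar> \<le> D))"

text \<open>A chain \<open>x 0, \<dots>, x n\<close> of length \<open>n\<close>; values of \<open>x\<close> beyond \<open>n\<close> are irrelevant.\<close>

definition is_chain ::
  "('a, 'b) monoid_scheme \<Rightarrow> 'a set \<Rightarrow> nat \<Rightarrow> 'a set \<Rightarrow> (nat \<Rightarrow> 'a) \<Rightarrow> nat \<Rightarrow> bool" where
  "is_chain G S C X x n \<longleftrightarrow>
     (\<forall>i\<le>n. x i \<in> X) \<and> (\<forall>i<n. word_dist G S (x i) (x (Suc i)) \<le> C)"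

definition C_connected :: "('a, 'b) monoid_scheme \<Rightarrow> 'a set \<Rightarrow> nat \<Rightarrow> 'a set \<Rightarrow> bool" where
  "C_connected G S C X \<longleftrightarrow>
     (\<forall>a\<in>X. \<forall>b\<in>X. \<exists>x n. is_chain G S C X x n \<and> x 0 = a \<and> x n = b)"

definition Cf_connected ::
  "('a, 'b) monoid_scheme \<Rightarrow> 'a set \<Rightarrow> nat \<Rightarrow> (nat \<Rightarrow> nat) \<Rightarrow> 'a set \<Rightarrow> bool" where
  "Cf_connected G S C f X \<longleftrightarrow>
     C_connected G S C X \<and>
     (\<forall>m>0. \<forall>a\<in>X. \<forall>b\<in>X. word_dist G S a b \<le> m \<longrightarrow>
        (\<exists>x n. is_chain G S C X x n \<and> x 0 = a \<and> x n = b \<and> n \<le> f m))"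

definition Cf_uniform ::
  "('a, 'b) monoid_scheme \<Rightarrow> 'a set \<Rightarrow> nat \<Rightarrow> (nat \<Rightarrow> nat) \<Rightarrow> ('a \<Rightarrow> int) \<Rightarrow> bool" where
  "Cf_uniform G S C f \<phi> \<longleftrightarrow>
     quasimorphism G (\<lambda>g. real_of_int (\<phi> g)) \<and>
     defect G (\<lambda>g. real_of_int (\<phi> g)) \<le> 1 \<and>
     (\<forall>g\<in>carrier G. \<exists>hp\<in>carrier G. \<exists>hm\<in>carrier G.
        word_dist G S g hp \<le> C \<and> word_dist G S g hm \<le> C \<and>
        \<phi> hp - \<phi> g = 1 \<and> \<phi> hm - \<phi> g = - 1) \<and>
     (\<forall>n. Cf_connected G S C f {g \<in> carrier G. \<phi> g = n})"

definition uniform_quasimorphism ::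
  "('a, 'b) monoid_scheme \<Rightarrow> 'a set \<Rightarrow> ('a \<Rightarrow> int) \<Rightarrow> bool" where
  "uniform_quasimorphism G S \<phi> \<longleftrightarrow> (\<exists>C f. C > 0 \<and> mono f \<and> Cf_uniform G S C f \<phi>)"

end

theory Submission
  imports Defs "HOL-Real_Asymp.Real_Asymp"
begin

text \<open>
  A quasimorphism \<open>\<phi>\<close> is coarsely Lipschitz, so a path with bounded steps along which \<open>\<phi>\<close> grows
  linearly escapes linearly and converges to a point of the boundary. Let \<open>Z\<^sup>+\<close> be the set of all
  such limits, and \<open>Z\<^sup>-\<close> the corresponding set for \<open>-\<phi>\<close>. A rising and a falling path cannot have
  the same limit, because \<open>\<phi>\<close> keeps them apart linearly.

  To join two points of \<open>Z\<^sup>+\<close>, connect the starting points of two rising paths by a chain in a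
  level set, push this chain up one level, and fill the resulting gaps by chains of bounded
  length in the new level; repeat. After scaling to \<open>[0, 1]\<close> this subdivides the interval at each
  step, so every \<open>t\<close> follows a rising path of its own, and parameters \<open>s\<close>, \<open>t\<close> that lie close
  together have paths that are still close at a high level, hence nearby limits.
\<close>

section \<open>The word metric\<close>

locale word_metric = group G for G (structure) +
  fixes S :: "'a set"
  assumes generating: "finite_symmetric_generating_set G S"
begin

abbreviation len :: "'a \<Rightarrow> nat" where "len \<equiv> word_length G S"
abbreviation dist_w :: "'a \<Rightarrow> 'a \<Rightarrow> nat" where "dist_w \<equiv> word_dist G S"
abbreviation gp :: "'a \<Rightarrow> 'a \<Rightarrow> 'a \<Rightarrow> real" where "gp \<equiv> gromov_product G S"
abbreviation eval_word :: "'a list \<Rightarrow> 'a" where "eval_word ws \<equiv> foldr (\<otimes>) ws \<one>"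

lemma S_carrier: "S \<subseteq> carrier G" and S_inv: "s \<in> S \<Longrightarrow> inv s \<in> S" and S_finite: "finite S"
  and S_generate: "generate G S = carrier G"
  using generating by (auto simp: finite_symmetric_generating_set_def)

lemma eval_word_closed: "set ws \<subseteq> S \<Longrightarrow> eval_word ws \<in> carrier G"
  using S_carrier by (induction ws) auto

lemma eval_word_append:
  "set us \<subseteq> S \<Longrightarrow> set ws \<subseteq> S \<Longrightarrow> eval_word (us @ ws) = eval_word us \<otimes> eval_word ws"
proof (induction us)
  case (Cons u us)
  then have "u \<in> carrier G" "eval_word us \<in> carrier G" "eval_word ws \<in> carrier G"
    using S_carrier by (auto intro: eval_word_closed)
  with Cons show ?case by (simp add: m_assoc)
qed (simp add: eval_word_closed)

lemma eval_word_rev_inv: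
  "set ws \<subseteq> S \<Longrightarrow> eval_word (rev (map (\<lambda>s. inv s) ws)) = inv (eval_word ws)"
proof (induction ws)
  case (Cons s ws)
  have s: "s \<in> carrier G" "inv s \<in> S" and ws: "set ws \<subseteq> S" "eval_word ws \<in> carrier G"
    using Cons.prems S_carrier S_inv eval_word_closed by auto
  have "eval_word (rev (map (\<lambda>s. inv s) (s # ws)))
      = eval_word (rev (map (\<lambda>s. inv s) ws)) \<otimes> eval_word [inv s]"
    using ws s S_inv by (simp only: list.map rev.simps, intro eval_word_append) auto
  also have "\<dots> = inv (eval_word (s # ws))"
    using Cons.IH ws s by (simp add: inv_mult_group)
  finally show ?case .
qed simp

lemma ex_word:
  assumes "g \<in> carrier G" shows "\<exists>ws. set ws \<subseteq> S \<and> eval_word ws = g"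
proof -
  have "g \<in> generate G S" using assms S_generate by simp
  then show ?thesis
  proof induction
    case one
    then show ?case by (intro exI[of _ "[]"]) simp
  next
    case (incl h)
    then show ?case using S_carrier by (intro exI[of _ "[h]"]) auto
  next
    case (inv h)
    then show ?case using S_carrier S_inv by (intro exI[of _ "[inv h]"]) auto
  next
    case (eng h1 h2)
    then obtain us ws where "set us \<subseteq> S" "eval_word us = h1" "set ws \<subseteq> S" "eval_word ws = h2"
      by blast
    then show ?case by (intro exI[of _ "us @ ws"]) (simp only: eval_word_append set_append, simp)
  qed
qed

lemma len_le: "set ws \<subseteq> S \<Longrightarrow> len (eval_word ws) \<le> length ws"
  unfolding word_length_def by (rule Least_le) blast

lemma shortest_word:
  assumes "g \<in> carrier G" obtains ws where "set ws \<subseteq> S" "length ws = len g" "eval_word ws = g"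
proof -
  have "\<exists>n ws. set ws \<subseteq> S \<and> length ws = n \<and> eval_word ws = g"
    using ex_word[OF assms] by blast
  from LeastI_ex[OF this] show ?thesis using that unfolding word_length_def by blast
qed

lemma len_one [simp]: "len \<one> = 0"
  using len_le[of "[]"] by simp

lemma len_mult: "g \<in> carrier G \<Longrightarrow> h \<in> carrier G \<Longrightarrow> len (g \<otimes> h) \<le> len g + len h"
proof -
  assume g: "g \<in> carrier G" and h: "h \<in> carrier G"
  obtain us where us: "set us \<subseteq> S" "length us = len g" "eval_word us = g" by (rule shortest_word[OF g])
  obtain ws where ws: "set ws \<subseteq> S" "length ws = len h" "eval_word ws = h" by (rule shortest_word[OF h])
  have "len (eval_word (us @ ws)) \<le> length (us @ ws)" using us ws by (intro len_le) auto
  then show ?thesis using us ws eval_word_append[of us ws] by simp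
qed

lemma len_inv: assumes "g \<in> carrier G" shows "len (inv g) = len g"
proof -
  have *: "len (inv g) \<le> len g" if g: "g \<in> carrier G" for g
  proof -
    obtain us where us: "set us \<subseteq> S" "length us = len g" "eval_word us = g"
      by (rule shortest_word[OF g])
    have "len (eval_word (rev (map (\<lambda>s. inv s) us))) \<le> length (rev (map (\<lambda>s. inv s) us))"
      using us S_inv by (intro len_le) auto
    then show ?thesis using us eval_word_rev_inv[of us] by simp
  qed
  show ?thesis using *[OF assms] *[of "inv g"] assms by simp
qed

lemma dist_refl [simp]: "x \<in> carrier G \<Longrightarrow> dist_w x x = 0"
  by (simp add: word_dist_def)

lemma dist_one: "x \<in> carrier G \<Longrightarrow> dist_w \<one> x = len x"
  by (simp add: word_dist_def)

lemma dist_sym: "x \<in> carrier G \<Longrightarrow> y \<in> carrier G \<Longrightarrow> dist_w x y = dist_w y x"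
  using len_inv[of "inv x \<otimes> y"] by (simp add: word_dist_def inv_mult_group)

lemma dist_triangle:
  assumes "x \<in> carrier G" "y \<in> carrier G" "z \<in> carrier G"
  shows "dist_w x z \<le> dist_w x y + dist_w y z"
proof -
  have "(inv x \<otimes> y) \<otimes> (inv y \<otimes> z) = inv x \<otimes> z"
    using assms by (metis inv_closed inv_solve_left m_assoc m_closed)
  then show ?thesis
    using len_mult[of "inv x \<otimes> y" "inv y \<otimes> z"] assms by (simp add: word_dist_def)
qed

lemma dist_left_mult:
  assumes "g \<in> carrier G" "x \<in> carrier G" "y \<in> carrier G"
  shows "dist_w (g \<otimes> x) (g \<otimes> y) = dist_w x y"
proof -
  have "inv (g \<otimes> x) \<otimes> (g \<otimes> y) = inv x \<otimes> (inv g \<otimes> g) \<otimes> y"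
    using assms by (simp only: inv_mult_group m_assoc inv_closed m_closed)
  then have "inv (g \<otimes> x) \<otimes> (g \<otimes> y) = inv x \<otimes> y"
    using assms by simp
  then show ?thesis by (simp add: word_dist_def)
qed

text \<open>Cut a shortest word for \<open>x\<close> after \<open>t\<close> letters: each piece
  bounds one distance from above, and the triangle inequality turns both bounds into
  equalities.\<close>

lemma geodesic_point:
  assumes x: "x \<in> carrier G" and t: "t \<le> dist_w \<one> x"
  obtains p where "p \<in> carrier G" "dist_w \<one> p = t" "dist_w p x = dist_w \<one> x - t"
proof -
  obtain ws where ws: "set ws \<subseteq> S" "length ws = len x" "eval_word ws = x" by (rule shortest_word[OF x])
  define p where "p = eval_word (take t ws)"
  define q where "q = eval_word (drop t ws)"
  have sub: "set (take t ws) \<subseteq> S" "set (drop t ws) \<subseteq> S"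
    using ws(1) set_take_subset[of t ws] set_drop_subset[of t ws] by blast+
  then have pq: "p \<in> carrier G" "q \<in> carrier G" by (auto simp: p_def q_def eval_word_closed)
  have t': "t \<le> len x" using t x by (simp add: dist_one)
  have "x = p \<otimes> q" using eval_word_append[OF sub] ws(3)
    by (simp only: append_take_drop_id p_def q_def)
  then have "inv p \<otimes> x = q" using pq by (metis inv_closed l_inv l_one m_assoc)
  then have "dist_w p x \<le> len x - t" using len_le[OF sub(2)] ws by (simp add: word_dist_def q_def)
  moreover have "dist_w \<one> p \<le> t" using len_le[OF sub(1)] ws pq t' by (simp add: dist_one p_def)
  moreover have "dist_w \<one> x \<le> dist_w \<one> p + dist_w p x" using dist_triangle pq x by simp
  ultimately show ?thesis using that[of p] pq x t' by (simp add: dist_one)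
qed

section \<open>Gromov products under change of base point and translation\<close>

lemma gp_double: "2 * gp p x y = real (dist_w p x) + real (dist_w p y) - real (dist_w x y)"
  by (simp add: gromov_product_def)

lemma gp_commute: "x \<in> carrier G \<Longrightarrow> y \<in> carrier G \<Longrightarrow> gp p x y = gp p y x"
  using dist_sym[of x y] by (simp add: gromov_product_def)

lemma gp_ge_left:
  assumes "p \<in> carrier G" "x \<in> carrier G" "y \<in> carrier G"
  shows "gp p x y \<ge> real (dist_w p x) - real (dist_w x y)"
  using dist_triangle[of p y x] dist_sym[of x y] assms by (simp add: gromov_product_def)

lemma gp_change_base:
  assumes "p \<in> carrier G" "q \<in> carrier G" "x \<in> carrier G" "y \<in> carrier G"
  shows "gp p x y \<ge> gp q x y - real (dist_w p q)"
proof -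
  have "real (dist_w q x) \<le> real (dist_w p q) + real (dist_w p x)"
    "real (dist_w q y) \<le> real (dist_w p q) + real (dist_w p y)"
    using dist_triangle[of q p x] dist_triangle[of q p y] dist_sym[of p q] assms by linarith+
  then show ?thesis using gp_double[of p x y] gp_double[of q x y] by linarith
qed

lemma gp_left_mult:
  assumes "g \<in> carrier G" "p \<in> carrier G" "x \<in> carrier G" "y \<in> carrier G"
  shows "gp (g \<otimes> p) (g \<otimes> x) (g \<otimes> y) = gp p x y"
  using assms by (simp add: gromov_product_def dist_left_mult)

text \<open>Moving the base point from \<open>\<one>\<close> to \<open>g\<close> costs at most
  \<open>len g\<close>; after that the isometry cancels.\<close>

lemma gp_left_mult_ge:
  assumes "g \<in> carrier G" "x \<in> carrier G" "y \<in> carrier G"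
  shows "gp \<one> (g \<otimes> x) (g \<otimes> y) \<ge> gp \<one> x y - real (len g)"
  using gp_change_base[of \<one> "g \<otimes> \<one>" "g \<otimes> x" "g \<otimes> y"] gp_left_mult[of g \<one> x y] assms
  by (simp add: dist_one)

lemma dist_chain:
  assumes x: "\<And>k. x k \<in> carrier G" and K: "\<And>k. dist_w (x k) (x (Suc k)) \<le> K"
  shows "dist_w (x i) (x (i + n)) \<le> K * n"
proof (induction n)
  case (Suc n)
  then show ?case
    using dist_triangle[OF x[of i] x[of "i + n"] x[of "Suc (i + n)"]] K[of "i + n"] by simp
qed (simp add: x)

end

section \<open>Sequences converging at infinity\<close>

locale hyperbolic = word_metric +
  fixes \<delta> :: real
  assumes delta_nonneg: "\<delta> \<ge> 0"
    and four_point: "\<lbrakk>p \<in> carrier G; x \<in> carrier G; y \<in> carrier G; z \<in> carrier G\<rbrakk>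
      \<Longrightarrow> gp p x z \<ge> min (gp p x y) (gp p y z) - \<delta>"
begin

lemma four_point_ge:
  "\<lbrakk>p \<in> carrier G; x \<in> carrier G; y \<in> carrier G; z \<in> carrier G; gp p x y \<ge> r; gp p y z \<ge> r\<rbrakk>
    \<Longrightarrow> gp p x z \<ge> r - \<delta>"
  using four_point[of p x y z] by linarith

lemma filterlim_gp_iff:
  fixes F :: "nat \<Rightarrow> nat \<Rightarrow> real"
  shows "filterlim (\<lambda>(i, j). F i j) at_top (sequentially \<times>\<^sub>F sequentially)
    \<longleftrightarrow> (\<forall>r. \<exists>N. \<forall>i\<ge>N. \<forall>j\<ge>N. F i j \<ge> r)" (is "?L \<longleftrightarrow> ?R")
  unfolding filterlim_at_top eventually_prod_sequentially case_prod_conv by blast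

lemma gromov_sequences_iff:
  "x \<in> gromov_sequences G S \<longleftrightarrow>
    (\<forall>k. x k \<in> carrier G) \<and> (\<forall>r. \<exists>N. \<forall>i\<ge>N. \<forall>j\<ge>N. gp \<one> (x i) (x j) \<ge> r)"
  unfolding gromov_sequences_def filterlim_gp_iff by (auto simp: image_subset_iff)

lemma gromov_sequences_closed: "x \<in> gromov_sequences G S \<Longrightarrow> x k \<in> carrier G"
  by (simp add: gromov_sequences_iff)

lemma gromov_equiv_iff:
  "(x, y) \<in> gromov_equiv G S \<longleftrightarrow> x \<in> gromov_sequences G S \<and> y \<in> gromov_sequences G S \<and>
    (\<forall>r. \<exists>N. \<forall>i\<ge>N. \<forall>j\<ge>N. gp \<one> (x i) (y j) \<ge> r)"
  unfolding gromov_equiv_def by (simp add: filterlim_gp_iff)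

lemma equiv_gromov_equiv: "equiv (gromov_sequences G S) (gromov_equiv G S)"
proof (rule equivI)
  show "gromov_equiv G S \<subseteq> gromov_sequences G S \<times> gromov_sequences G S"
    by (auto simp: gromov_equiv_def)
  show "refl_on (gromov_sequences G S) (gromov_equiv G S)"
    by (rule refl_onI) (auto simp: gromov_equiv_iff gromov_sequences_iff)
  show "sym (gromov_equiv G S)"
  proof (rule symI)
    fix x y assume xy: "(x, y) \<in> gromov_equiv G S"
    then have "gp \<one> (x i) (y j) = gp \<one> (y j) (x i)" for i j
      by (intro gp_commute gromov_sequences_closed) (auto simp: gromov_equiv_iff)
    with xy show "(y, x) \<in> gromov_equiv G S" unfolding gromov_equiv_iff by metis
  qed
  show "trans (gromov_equiv G S)"
  proof (rule transI)
    fix x y z assume xy: "(x, y) \<in> gromov_equiv G S" and yz: "(y, z) \<in> gromov_equiv G S"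
    have c: "x k \<in> carrier G" "y k \<in> carrier G" "z k \<in> carrier G" for k
      using xy yz by (auto simp: gromov_equiv_iff gromov_sequences_closed)
    have "\<exists>N. \<forall>i\<ge>N. \<forall>j\<ge>N. gp \<one> (x i) (z j) \<ge> r" for r
    proof -
      obtain N1 where N1: "\<And>i j. i \<ge> N1 \<Longrightarrow> j \<ge> N1 \<Longrightarrow> gp \<one> (x i) (y j) \<ge> r + \<delta>"
        using xy unfolding gromov_equiv_iff by blast
      obtain N2 where N2: "\<And>i j. i \<ge> N2 \<Longrightarrow> j \<ge> N2 \<Longrightarrow> gp \<one> (y i) (z j) \<ge> r + \<delta>"
        using yz unfolding gromov_equiv_iff by blast
      \<comment> \<open>The intermediate point is \<open>y i\<close>: its index is large enough for
        both hypotheses.\<close>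
      have "gp \<one> (x i) (z j) \<ge> r" if "i \<ge> max N1 N2" "j \<ge> max N1 N2" for i j
        using four_point_ge[of \<one> "x i" "y i" "z j" "r + \<delta>"] N1[of i i] N2[of i j] c that by simp
      then show ?thesis by blast
    qed
    then show "(x, z) \<in> gromov_equiv G S" using xy yz by (simp add: gromov_equiv_iff)
  qed
qed

lemma gromov_boundary_class: "x \<in> gromov_sequences G S \<Longrightarrow> gromov_equiv G S `` {x} \<in> gromov_boundary G S"
  unfolding gromov_boundary_def by (rule quotientI)

lemma class_self: "x \<in> gromov_sequences G S \<Longrightarrow> x \<in> gromov_equiv G S `` {x}"
  using equiv_class_self[OF equiv_gromov_equiv] .

lemma class_eq_iff:
  "x \<in> gromov_sequences G S \<Longrightarrow> y \<in> gromov_sequences G S \<Longrightarrow>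
   gromov_equiv G S `` {x} = gromov_equiv G S `` {y} \<longleftrightarrow> (x, y) \<in> gromov_equiv G S"
  using equiv_class_eq_iff[OF equiv_gromov_equiv] by blast

text \<open>Replacing \<open>x j\<close> by \<open>y j\<close> alters each of the two distances
  involved by at most \<open>R\<close>, hence the product by at most \<open>R\<close> after
  halving.\<close>

lemma bounded_distance_equiv:
  assumes x: "x \<in> gromov_sequences G S" and y: "y \<in> gromov_sequences G S"
    and R: "\<And>k. dist_w (x k) (y k) \<le> R"
  shows "(x, y) \<in> gromov_equiv G S"
proof -
  have c: "x k \<in> carrier G" "y k \<in> carrier G" for k using x y by (auto simp: gromov_sequences_closed)
  have "\<exists>N. \<forall>i\<ge>N. \<forall>j\<ge>N. gp \<one> (x i) (y j) \<ge> r" for r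
  proof -
    obtain N where N: "\<And>i j. i \<ge> N \<Longrightarrow> j \<ge> N \<Longrightarrow> gp \<one> (x i) (x j) \<ge> r + real R"
      using x unfolding gromov_sequences_iff by blast
    have "gp \<one> (x i) (y j) \<ge> r" if "i \<ge> N" "j \<ge> N" for i j
    proof -
      have "dist_w \<one> (x j) \<le> dist_w \<one> (y j) + dist_w (x j) (y j)"
        "dist_w (x i) (y j) \<le> dist_w (x i) (x j) + dist_w (x j) (y j)"
        using dist_triangle[of \<one> "y j" "x j"] dist_sym[of "x j" "y j"]
          dist_triangle[of "x i" "x j" "y j"] c by auto
      with N[OF that] R[of j] show ?thesis by (simp add: gromov_product_def)
    qed
    then show ?thesis by blast
  qed
  with x y show ?thesis by (simp add: gromov_equiv_iff)
qed

lemma left_mult_gromov_equiv: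
  assumes g: "g \<in> carrier G" and xy: "(x, y) \<in> gromov_equiv G S"
  shows "((\<lambda>n. g \<otimes> x n), (\<lambda>n. g \<otimes> y n)) \<in> gromov_equiv G S"
proof -
  have *: "\<exists>N. \<forall>i\<ge>N. \<forall>j\<ge>N. gp \<one> (g \<otimes> u i) (g \<otimes> v j) \<ge> r"
    if uv: "(u, v) \<in> gromov_equiv G S" for u v r
  proof -
    obtain N where N: "\<And>i j. i \<ge> N \<Longrightarrow> j \<ge> N \<Longrightarrow> gp \<one> (u i) (v j) \<ge> r + real (len g)"
      using uv unfolding gromov_equiv_iff by blast
    have "gp \<one> (g \<otimes> u i) (g \<otimes> v j) \<ge> r" if "i \<ge> N" "j \<ge> N" for i j
      using gp_left_mult_ge[of g "u i" "v j"] N[OF that] g uv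
      by (auto simp: gromov_equiv_iff gromov_sequences_closed)
    then show ?thesis by blast
  qed
  have "(x, x) \<in> gromov_equiv G S" "(y, y) \<in> gromov_equiv G S"
    using xy class_self by (auto simp: gromov_equiv_iff)
  with xy *[of x x] *[of y y] *[of x y] g show ?thesis
    by (simp add: gromov_equiv_iff gromov_sequences_iff)
qed

text \<open>One inclusion is invariance of the relation under translation; for the other,
  translation by \<open>inv g\<close> carries each member of the target class back to the class of
  \<open>x\<close>.\<close>

lemma boundary_act_class:
  assumes g: "g \<in> carrier G" and x: "x \<in> gromov_sequences G S"
  shows "boundary_act G g (gromov_equiv G S `` {x}) = gromov_equiv G S `` {\<lambda>n. g \<otimes> x n}"
proof (intro subset_antisym subsetI)
  fix y assume "y \<in> boundary_act G g (gromov_equiv G S `` {x})"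
  then show "y \<in> gromov_equiv G S `` {\<lambda>n. g \<otimes> x n}"
    using left_mult_gromov_equiv[OF g] by (auto simp: boundary_act_def)
next
  fix y assume "y \<in> gromov_equiv G S `` {\<lambda>n. g \<otimes> x n}"
  then have y: "((\<lambda>n. g \<otimes> x n), y) \<in> gromov_equiv G S" by simp
  define z where "z = (\<lambda>n. inv g \<otimes> y n)"
  have xc: "x n \<in> carrier G" and yc: "y n \<in> carrier G" for n
    using x y by (auto simp: gromov_equiv_iff gromov_sequences_closed)
  have "((\<lambda>n. inv g \<otimes> (g \<otimes> x n)), z) \<in> gromov_equiv G S"
    unfolding z_def using left_mult_gromov_equiv[OF _ y, of "inv g"] g by simp
  moreover have "inv g \<otimes> (g \<otimes> x n) = x n" "g \<otimes> z n = y n" for n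
    using g xc yc by (simp_all add: z_def m_assoc[symmetric])
  ultimately have "(x, z) \<in> gromov_equiv G S" "y = (\<lambda>n. g \<otimes> z n)" by auto
  then show "y \<in> boundary_act G g (gromov_equiv G S `` {x})" by (auto simp: boundary_act_def)
qed

text \<open>A path with bounded steps that escapes linearly converges: cut it into blocks so long that
  the distance to the base point grows by at least \<open>\<delta>\<close> per block; this growth absorbs the
  error \<open>\<delta>\<close> that the four-point condition loses at each block.\<close>

lemma gp_linear_escape:
  assumes x: "\<And>k. x k \<in> carrier G" and K: "\<And>k. dist_w (x k) (x (Suc k)) \<le> K"
    and esc: "\<And>k. real (dist_w \<one> (x k)) \<ge> c * real k - b"
    and M: "c * real M \<ge> \<delta>" "M > 0" and c: "c \<ge> 0" and ij: "i \<le> j"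
  shows "gp \<one> (x i) (x j) \<ge> c * real i - (b + real (K * M) + \<delta>)"
  using ij
proof (induction "j - i" arbitrary: i rule: less_induct)
  case less
  \<comment> \<open>Within one block the triangle inequality suffices and leaves a spare \<delta>,
    which pays for the four-point step of the induction.\<close>
  have near: "gp \<one> (x i) (x (i + n)) \<ge> c * real i - (b + real (K * M))" if "n \<le> M" for i n
  proof -
    have "dist_w (x i) (x (i + n)) \<le> K * n" by (rule dist_chain) (rule x K)+
    also have "\<dots> \<le> K * M" using that by simp
    finally have "real (dist_w (x i) (x (i + n))) \<le> real (K * M)" by linarith
    then show ?thesis using gp_ge_left[of \<one> "x i" "x (i + n)"] esc[of i] x by fastforce
  qed
  show ?case
  proof (cases "j - i \<le> M")
    case True
    then show ?thesis using near[of "j - i" i] less.prems delta_nonneg by simp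
  next
    case False
    have "gp \<one> (x (i + M)) (x j) \<ge> c * real (i + M) - (b + real (K * M) + \<delta>)"
      using less.hyps[of "i + M"] False M by simp
    also have "c * real (i + M) - (b + real (K * M) + \<delta>) \<ge> c * real i - (b + real (K * M))"
      using M by (simp add: algebra_simps)
    finally show ?thesis
      using four_point_ge[of \<one> "x i" "x (i + M)" "x j" "c * real i - (b + real (K * M))"] near[of M i] x
      by simp
  qed
qed

text \<open>Repeated halving arranges the four-point steps in a binary tree of depth
  \<open>m\<close>, so the loss grows with the logarithm of the length and not with the
  length.\<close>

lemma gp_chain:
  assumes p: "p \<in> carrier G" and x: "\<And>k. x k \<in> carrier G" and "n \<le> 2 ^ m"
    and r: "\<And>k. k < n \<Longrightarrow> gp p (x (i + k)) (x (i + Suc k)) \<ge> r" and "n > 0"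
  shows "gp p (x i) (x (i + n)) \<ge> r - \<delta> * real m"
  using assms(3-5)
proof (induction m arbitrary: i n)
  case 0
  then show ?case using "0.prems"(2)[of 0] by (cases "n = 1") auto
next
  case (Suc m)
  show ?case
  proof (cases "n \<le> 2 ^ m")
    case True
    then have "gp p (x i) (x (i + n)) \<ge> r - \<delta> * real m" using Suc by blast
    then show ?thesis using delta_nonneg by (simp add: algebra_simps)
  next
    case False
    \<comment> \<open>The first part has exactly \<open>2 ^ m\<close> steps; the rest is nonempty
      and has at most \<open>2 ^ m\<close>.\<close>
    let ?h = "2 ^ m"
    have 1: "gp p (x i) (x (i + ?h)) \<ge> r - \<delta> * real m" using Suc False by simp
    have "gp p (x (i + ?h)) (x (i + ?h + (n - ?h))) \<ge> r - \<delta> * real m"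
    proof (rule Suc.IH)
      show "n - ?h \<le> 2 ^ m" "0 < n - ?h" using Suc.prems False by auto
      show "gp p (x (i + ?h + k)) (x (i + ?h + Suc k)) \<ge> r" if "k < n - ?h" for k
        using Suc.prems(2)[of "?h + k"] that by (simp add: add.assoc)
    qed
    then have "gp p (x (i + ?h)) (x (i + n)) \<ge> r - \<delta> * real m" using False by simp
    from four_point_ge[OF p x x x 1 this] show ?thesis by (simp add: algebra_simps)
  qed
qed

text \<open>Consecutive points have product at \<open>p\<close> at least their distance from
  \<open>p\<close> minus \<open>K\<close>. If all points were farther from \<open>p\<close> than
  claimed, \<open>gp_chain\<close> would make the product of the endpoints exceed itself.\<close>

lemma chain_near_point:
  assumes p: "p \<in> carrier G" and x: "\<And>k. x k \<in> carrier G"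
    and K: "\<And>k. dist_w (x k) (x (Suc k)) \<le> K"
  shows "\<exists>k\<le>2 ^ m. real (dist_w p (x k)) \<le> gp p (x 0) (x (2 ^ m)) + real K + \<delta> * real m"
proof (rule ccontr)
  assume "\<not> ?thesis"
  then have far: "real (dist_w p (x k)) > gp p (x 0) (x (2 ^ m)) + real K + \<delta> * real m"
    if "k \<le> 2 ^ m" for k using that by (metis not_less)
  \<comment> \<open>A minimum over finitely many points is one bound that keeps the strict
    inequality.\<close>
  define r where "r = Min ((\<lambda>k. real (dist_w p (x k))) ` {..(2::nat) ^ m})"
  have r: "r > gp p (x 0) (x (2 ^ m)) + real K + \<delta> * real m"
    unfolding r_def using far by (subst Min_gr_iff) auto
  have "gp p (x (0 + k)) (x (0 + Suc k)) \<ge> r - real K" if "k < 2 ^ m" for k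
  proof -
    have "r \<le> real (dist_w p (x k))" unfolding r_def using that by (intro Min_le) auto
    moreover have "real (dist_w (x k) (x (Suc k))) \<le> real K" using K by simp
    moreover have "gp p (x k) (x (Suc k)) \<ge> real (dist_w p (x k)) - real (dist_w (x k) (x (Suc k)))"
      using gp_ge_left[OF p x x] .
    ultimately show ?thesis by simp
  qed
  then have "gp p (x 0) (x (0 + 2 ^ m)) \<ge> r - real K - \<delta> * real m"
    by (intro gp_chain p x) auto
  with r show False by simp
qed

end

section \<open>Sequences along which an integer-valued function rises\<close>

context hyperbolic
begin

text \<open>The function is arbitrary, so falling paths are the rising paths of
  \<open>\<lambda>g. - \<phi> g\<close>. With \<open>b = 0\<close> the point \<open>x k\<close> lies
  exactly on level \<open>k\<close>.\<close>

definition rising :: "('a \<Rightarrow> int) \<Rightarrow> nat \<Rightarrow> int \<Rightarrow> (nat \<Rightarrow> 'a) \<Rightarrow> bool" where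
  "rising \<phi> K b x \<longleftrightarrow> (\<forall>k. x k \<in> carrier G \<and> dist_w (x k) (x (Suc k)) \<le> K \<and> \<bar>\<phi> (x k) - int k\<bar> \<le> b)"

text \<open>The constants may vary from path to path because translation by a group element changes
  \<open>b\<close>.\<close>

definition rising_ends :: "('a \<Rightarrow> int) \<Rightarrow> (nat \<Rightarrow> 'a) set set" where
  "rising_ends \<phi> = {gromov_equiv G S `` {x} |x. \<exists>K b. rising \<phi> K b x}"

definition coarsely_lipschitz :: "('a \<Rightarrow> int) \<Rightarrow> int \<Rightarrow> int \<Rightarrow> bool" where
  "coarsely_lipschitz \<phi> A B \<longleftrightarrow> A > 0 \<and>
    (\<forall>g\<in>carrier G. \<forall>h\<in>carrier G. \<bar>\<phi> h - \<phi> g\<bar> \<le> A * int (dist_w g h) + B)"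

lemma risingD:
  assumes "rising \<phi> K b x"
  shows "x k \<in> carrier G" "dist_w (x k) (x (Suc k)) \<le> K" "\<bar>\<phi> (x k) - int k\<bar> \<le> b"
  using assms by (auto simp: rising_def)

lemma rising_weaken:
  "rising \<phi> K b x \<Longrightarrow> K \<le> K' \<Longrightarrow> b \<le> b' \<Longrightarrow> rising \<phi> K' b' x"
  unfolding rising_def by (meson order_trans)

text \<open>The Lipschitz bound turns growth of \<phi> into escape at rate \<open>1 / A\<close>, and
  \<open>gp_linear_escape\<close> applies. Since \<open>c\<close> and \<open>R\<close> are chosen
  before \<open>x\<close>, the estimate is uniform over all paths with the same \<open>K\<close> and
  \<open>b\<close>; continuity of the path of ends rests on this.\<close>

lemma rising_linear_escape:
  assumes lip: "coarsely_lipschitz \<phi> A B"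
  shows "\<exists>c R. c > 0 \<and> (\<forall>x. rising \<phi> K b x \<longrightarrow>
           (\<forall>k i j. k \<le> i \<longrightarrow> k \<le> j \<longrightarrow> gp \<one> (x i) (x j) \<ge> c * real k - R))"
proof -
  have A: "A > 0" using lip by (simp add: coarsely_lipschitz_def)
  define c where "c = 1 / real_of_int A"
  define b' where "b' = c * real_of_int (b + \<phi> \<one> + B)"
  have c: "c > 0" using A by (simp add: c_def)
  obtain M0 where M0: "\<delta> / c < real M0" using reals_Archimedean2 by blast
  define M where "M = Suc M0"
  have M: "c * real M \<ge> \<delta>" "M > 0" using M0 c by (auto simp: M_def field_simps)
  define R where "R = b' + real (K * M) + \<delta>"
  have main: "gp \<one> (x i) (x j) \<ge> c * real k - R" if x: "rising \<phi> K b x" and "k \<le> i" "i \<le> j" for x k i j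
  proof -
    have esc: "real (dist_w \<one> (x k)) \<ge> c * real k - b'" for k
    proof -
      have "\<bar>\<phi> (x k) - \<phi> \<one>\<bar> \<le> A * int (dist_w \<one> (x k)) + B"
        using lip risingD[OF x] by (auto simp: coarsely_lipschitz_def)
      with risingD(3)[OF x, of k] have "int k \<le> A * int (dist_w \<one> (x k)) + (b + \<phi> \<one> + B)" by linarith
      then have "real_of_int (int k) \<le> real_of_int (A * int (dist_w \<one> (x k)) + (b + \<phi> \<one> + B))"
        by (simp only: of_int_le_iff)
      then have "c * real k \<le> c * (real_of_int A * real (dist_w \<one> (x k)) + real_of_int (b + \<phi> \<one> + B))"
        using c by (intro mult_left_mono) auto
      also have "\<dots> = real (dist_w \<one> (x k)) + b'" using A by (simp add: c_def b'_def distrib_left)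
      finally show ?thesis by simp
    qed
    have "c * real i \<ge> c * real k" using that c by simp
    moreover have "gp \<one> (x i) (x j) \<ge> c * real i - R"
      unfolding R_def by (rule gp_linear_escape) (use risingD[OF x] esc M c that in auto)
    ultimately show ?thesis by linarith
  qed
  have "gp \<one> (x i) (x j) \<ge> c * real k - R" if x: "rising \<phi> K b x" and "k \<le> i" "k \<le> j" for x k i j
    using main[OF x, of k i j] main[OF x, of k j i] gp_commute[of "x i" "x j" \<one>] risingD[OF x] that
    by (cases "i \<le> j") auto
  with c show ?thesis by blast
qed

lemma rising_gromov_sequence:
  assumes lip: "coarsely_lipschitz \<phi> A B" and x: "rising \<phi> K b x"
  shows "x \<in> gromov_sequences G S"
proof -
  obtain c R where c: "c > 0"
    and R: "\<And>k i j. k \<le> i \<Longrightarrow> k \<le> j \<Longrightarrow> gp \<one> (x i) (x j) \<ge> c * real k - R"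
    using rising_linear_escape[OF lip] x by metis
  have "\<exists>N. \<forall>i\<ge>N. \<forall>j\<ge>N. gp \<one> (x i) (x j) \<ge> r" for r
  proof -
    obtain N where "(r + R) / c < real N" using reals_Archimedean2 by blast
    then have "c * real N - R \<ge> r" using c by (simp add: field_simps)
    with R show ?thesis by (meson order_trans)
  qed
  then show ?thesis using risingD[OF x] by (simp add: gromov_sequences_iff)
qed

lemma rising_bounded_distance_equiv:
  assumes lip: "coarsely_lipschitz \<phi> A B" and x: "rising \<phi> K b x" and y: "rising \<phi> K' b' y"
    and R: "\<And>k. dist_w (x k) (y k) \<le> R"
  shows "gromov_equiv G S `` {x} = gromov_equiv G S `` {y}"
proof -
  have "x \<in> gromov_sequences G S" "y \<in> gromov_sequences G S"
    using rising_gromov_sequence[OF lip] x y by blast+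
  then show ?thesis using bounded_distance_equiv[of x y R] R class_eq_iff by blast
qed

section \<open>Separation of rising and falling paths\<close>

lemma gp_move_point:
  assumes "p \<in> carrier G" "x \<in> carrier G" "x' \<in> carrier G" "y \<in> carrier G"
  shows "gp p x' y \<le> gp p x y + real (dist_w x x')"
proof -
  have "real (dist_w p x') \<le> real (dist_w p x) + real (dist_w x x')"
    "real (dist_w x y) \<le> real (dist_w x x') + real (dist_w x' y)"
    using dist_triangle[of p x x'] dist_triangle[of x x' y] assms by linarith+
  then show ?thesis using gp_double[of p x y] gp_double[of p x' y] by linarith
qed

text \<open>For \<open>p\<close> near a geodesic from \<open>\<one>\<close> to \<open>x\<close>,
  \<open>gp \<one> p x\<close> is nearly \<open>dist_w \<one> p\<close>, so the product based at
  \<open>p\<close> is nearly zero.\<close>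

lemma gp_switch_base:
  assumes "p \<in> carrier G" "x \<in> carrier G"
  shows "gp p \<one> x = real (dist_w \<one> p) - gp \<one> p x"
  using gp_double[of p \<one> x] gp_double[of \<one> p x] dist_sym[of p \<one>] assms by simp

text \<open>If a rising and a falling path had the same end, then a point \<open>p\<close> on a geodesic towards
  this end, at distance about \<open>2 ^ m\<close> from the identity, would be at distance \<open>O(m)\<close> from both
  paths. But points of the two paths that far out are at distance at least a multiple of \<open>2 ^ m\<close>
  from each other, since \<open>\<phi>\<close> separates them.\<close>

lemma rising_falling_not_equiv:
  assumes lip: "coarsely_lipschitz \<phi> A B" and x: "rising \<phi> K b x"
    and y: "rising (\<lambda>g. - \<phi> g) K b y" and xy: "(x, y) \<in> gromov_equiv G S"
  shows False
proof -
  have lip': "coarsely_lipschitz (\<lambda>g. - \<phi> g) A B"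
    using lip by (auto simp: coarsely_lipschitz_def abs_minus_commute)
  have A: "A > 0" using lip by (simp add: coarsely_lipschitz_def)
  note xc = risingD(1)[OF x] and yc = risingD(1)[OF y]
  obtain c1 R1 where c1: "c1 > 0"
    and R1: "\<And>k i j. k \<le> i \<Longrightarrow> k \<le> j \<Longrightarrow> gp \<one> (x i) (x j) \<ge> c1 * real k - R1"
    using rising_linear_escape[OF lip] x by metis
  obtain c2 R2 where c2: "c2 > 0"
    and R2: "\<And>k i j. k \<le> i \<Longrightarrow> k \<le> j \<Longrightarrow> gp \<one> (y i) (y j) \<ge> c2 * real k - R2"
    using rising_linear_escape[OF lip'] y by metis
  \<comment> \<open>A common rate and error term for both paths; the absolute values make
    \<open>R\<close> at least \<open>R1\<close> and \<open>R2\<close>.\<close>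
  define c where "c = min c1 c2"
  define R where "R = \<bar>R1\<bar> + \<bar>R2\<bar>"
  have c: "c > 0" using c1 c2 by (simp add: c_def)
  have R_le: "c * real k - R \<le> c1 * real k - R1" "c * real k - R \<le> c2 * real k - R2" for k
    using mult_right_mono[of c c1 "real k"] mult_right_mono[of c c2 "real k"]
    by (simp_all add: c_def R_def)
  define d0 where "d0 = real (dist_w \<one> (x 0)) + real (dist_w \<one> (y 0))"
  \<comment> \<open>\<open>E m\<close> will bound the distance from \<open>p\<close> to either path:
    \<open>2 * \<delta> + d0\<close> bounds the product of two path points at \<open>p\<close>, and
    \<open>chain_near_point\<close> adds the rest.\<close>
  define E where "E m = 2 * \<delta> + d0 + real K + \<delta> * real m" for m :: nat
  have bound: "c * 2 ^ m - R - 1 \<le> d0 + real K * (2 * real_of_int A * E m + real_of_int (2 * b + B)) + E m"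
    if pos: "c * 2 ^ m - R \<ge> 0" for m :: nat
  proof -
    define i where "i = (2 :: nat) ^ m"
    define t where "t = nat \<lfloor>c * 2 ^ m - R\<rfloor>"
    have t: "real t \<le> c * real i - R" "c * 2 ^ m - R - 1 \<le> real t"
      using pos by (simp_all add: t_def i_def)
    obtain N where N: "\<And>i j. i \<ge> N \<Longrightarrow> j \<ge> N \<Longrightarrow> gp \<one> (x i) (y j) \<ge> real t"
      using xy unfolding gromov_equiv_iff by blast
    \<comment> \<open>The index lies beyond both \<open>N\<close> and \<open>i\<close>:
      \<open>p\<close> is placed on a geodesic to \<open>x n\<close>, and \<open>x n\<close>,
      \<open>y n\<close> serve as intermediate points when \<open>p\<close> is compared with
      \<open>x i\<close> and \<open>y i\<close>.\<close>
    define n where "n = max N i"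
    have xin: "gp \<one> (x i) (x n) \<ge> real t" and xnn: "gp \<one> (x n) (x n) \<ge> real t"
      and yin: "gp \<one> (y n) (y i) \<ge> real t" and xyn: "gp \<one> (x n) (y n) \<ge> real t"
      using R1[of i i n] R1[of i n n] R2[of i n i] N[of n n] R_le[of i] t by (auto simp: n_def)
    have "t \<le> dist_w \<one> (x n)" using xnn xc[of n] by (simp add: gromov_product_def)
    then obtain p where p: "p \<in> carrier G" "dist_w \<one> p = t" "dist_w p (x n) = dist_w \<one> (x n) - t"
      using geodesic_point xc by metis
    have pxn: "gp \<one> p (x n) \<ge> real t"
      using p(2,3) \<open>t \<le> _\<close> by (simp add: gromov_product_def)
    have pxi: "gp \<one> p (x i) \<ge> real t - \<delta>"
      using four_point_ge[of \<one> p "x n" "x i" "real t"] pxn xin gp_commute[of "x i" "x n" \<one>] p(1) xc by simp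
    have "gp \<one> p (y n) \<ge> real t - \<delta>"
      using four_point_ge[of \<one> p "x n" "y n" "real t"] pxn xyn p(1) xc yc by simp
    then have pyi: "gp \<one> p (y i) \<ge> real t - 2 * \<delta>"
      using four_point_ge[of \<one> p "y n" "y i" "real t - \<delta>"] yin p(1) yc delta_nonneg by simp
    \<comment> \<open>By \<open>pxi\<close> the product of \<open>\<one>\<close> and
      \<open>x i\<close> at \<open>p\<close> is at most \<delta>; moving \<open>\<one>\<close> to
      \<open>x 0\<close> costs at most \<open>d0\<close>.\<close>
    have "gp p (x 0) (x i) \<le> 2 * \<delta> + d0"
      using gp_move_point[of p \<one> "x 0" "x i"] gp_switch_base[of p "x i"] pxi p xc delta_nonneg
      by (simp add: d0_def)
    moreover obtain k where
      "real (dist_w p (x k)) \<le> gp p (x 0) (x i) + real K + \<delta> * real m"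
      using chain_near_point[where x = x and m = m, OF p(1) xc risingD(2)[OF x]]
      unfolding i_def by blast
    ultimately have k: "real (dist_w p (x k)) \<le> E m" by (simp add: E_def)
    have "gp p (y 0) (y i) \<le> 2 * \<delta> + d0"
      using gp_move_point[of p \<one> "y 0" "y i"] gp_switch_base[of p "y i"] pyi p yc
      by (simp add: d0_def)
    moreover obtain l where
      "real (dist_w p (y l)) \<le> gp p (y 0) (y i) + real K + \<delta> * real m"
      using chain_near_point[where x = y and m = m, OF p(1) yc risingD(2)[OF y]]
      unfolding i_def by blast
    ultimately have l: "real (dist_w p (y l)) \<le> E m" by (simp add: E_def)
    have "real (dist_w (y l) (x k)) \<le> real (dist_w p (y l)) + real (dist_w p (x k))"
      using dist_triangle[of "y l" p "x k"] dist_sym[of p "y l"] p xc yc by fastforce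
    then have near: "real (dist_w (y l) (x k)) \<le> 2 * E m" using k l by linarith
    \<comment> \<open>Height is at least \<open>k - b\<close> at \<open>x k\<close> and at most
      \<open>b - l\<close> at \<open>y l\<close>, so closeness of the two points bounds
      \<open>k\<close> linearly in \<open>m\<close>.\<close>
    have "\<bar>\<phi> (x k) - \<phi> (y l)\<bar> \<le> A * int (dist_w (y l) (x k)) + B"
      using lip xc yc by (auto simp: coarsely_lipschitz_def)
    with risingD(3)[OF x, of k] risingD(3)[OF y, of l]
    have "int k \<le> A * int (dist_w (y l) (x k)) + (2 * b + B)" by linarith
    then have "real_of_int (int k) \<le> real_of_int (A * int (dist_w (y l) (x k)) + (2 * b + B))"
      by (simp only: of_int_le_iff)
    also have "\<dots> = real_of_int A * real (dist_w (y l) (x k)) + real_of_int (2 * b + B)" by simp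
    also have "\<dots> \<le> real_of_int A * (2 * E m) + real_of_int (2 * b + B)"
      using near A by (intro add_right_mono mult_left_mono) auto
    finally have "real k \<le> 2 * real_of_int A * E m + real_of_int (2 * b + B)" by simp
    then have Kk: "real K * real k \<le> real K * (2 * real_of_int A * E m + real_of_int (2 * b + B))"
      by (intro mult_left_mono) auto
    \<comment> \<open>As \<open>k\<close> is small, \<open>x k\<close> and with it \<open>p\<close>
      is close to \<open>\<one>\<close>, although \<open>p\<close> is at distance \<open>t\<close>
      from it.\<close>
    have "dist_w (x 0) (x (0 + k)) \<le> K * k" by (rule dist_chain) (rule xc risingD(2)[OF x])+
    then have "dist_w \<one> (x k) \<le> dist_w \<one> (x 0) + K * k"
      using dist_triangle[of \<one> "x 0" "x k"] xc by fastforce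
    moreover have "dist_w \<one> p \<le> dist_w \<one> (x k) + dist_w p (x k)"
      using dist_triangle[of \<one> "x k" p] dist_sym[of "x k" p] p xc by simp
    ultimately have "real t \<le> real (dist_w \<one> (x 0)) + real K * real k + real (dist_w p (x k))"
      using p(2) by (simp flip: of_nat_mult of_nat_add)
    with Kk k t(2) show ?thesis by (simp add: d0_def)
  qed
  \<comment> \<open>\<open>P\<close> and \<open>Q\<close> collect the constant part and the
    coefficient of \<open>m\<close> in \<open>bound\<close>: an exponential in \<open>m\<close>
    would be at most linear.\<close>
  define P where "P = R + 1 + d0 + real K * (2 * real_of_int A * (2 * \<delta> + d0 + real K) + real_of_int (2 * b + B))
    + 2 * \<delta> + d0 + real K"
  define Q where "Q = real K * (2 * real_of_int A * \<delta>) + \<delta>"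
  have PQ: "c * 2 ^ m \<le> P + Q * real m" if "c * 2 ^ m - R \<ge> 0" for m :: nat
    using bound[OF that] by (simp add: P_def Q_def E_def algebra_simps)
  have "eventually (\<lambda>m::nat. c * 2 ^ m - R \<ge> 0) sequentially" using c by real_asymp
  moreover have "eventually (\<lambda>m::nat. c * 2 ^ m > P + Q * real m) sequentially" using c by real_asymp
  ultimately have "eventually (\<lambda>m::nat. False) sequentially"
    by eventually_elim (use PQ in force)
  then show False by simp
qed

end

section \<open>Uniform quasimorphisms\<close>

locale uniform_height = hyperbolic +
  fixes \<phi> :: "'a \<Rightarrow> int" and D :: int and C :: nat and f :: "nat \<Rightarrow> nat"
  assumes quasi: "\<lbrakk>g \<in> carrier G; h \<in> carrier G\<rbrakk> \<Longrightarrow> \<bar>\<phi> (g \<otimes> h) - \<phi> g - \<phi> h\<bar> \<le> D"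
    and step_up: "g \<in> carrier G \<Longrightarrow> \<exists>h\<in>carrier G. dist_w g h \<le> C \<and> \<phi> h = \<phi> g + 1"
    and step_down: "g \<in> carrier G \<Longrightarrow> \<exists>h\<in>carrier G. dist_w g h \<le> C \<and> \<phi> h = \<phi> g - 1"
    and level_connected: "Cf_connected G S C f {g \<in> carrier G. \<phi> g = n}"
begin

text \<open>Negation exchanges the two step conditions and maps level \<open>n\<close> to level
  \<open>- n\<close>, so every result on rising ends is available for falling ends.\<close>

lemma uniform_height_uminus: "uniform_height G S \<delta> (\<lambda>g. - \<phi> g) D C f"
proof unfold_locales
  fix g h assume "g \<in> carrier G" "h \<in> carrier G"
  then show "\<bar>- \<phi> (g \<otimes> h) - - \<phi> g - - \<phi> h\<bar> \<le> D" using quasi[of g h] by linarith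
next
  fix g assume "g \<in> carrier G"
  then show "\<exists>h\<in>carrier G. dist_w g h \<le> C \<and> - \<phi> h = - \<phi> g + 1"
    "\<exists>h\<in>carrier G. dist_w g h \<le> C \<and> - \<phi> h = - \<phi> g - 1"
    using step_down[of g] step_up[of g] by force+
next
  fix n
  have "{g \<in> carrier G. - \<phi> g = n} = {g \<in> carrier G. \<phi> g = - n}" by auto
  then show "Cf_connected G S C f {g \<in> carrier G. - \<phi> g = n}" using level_connected[of "- n"] by simp
qed

text \<open>Each letter of a shortest word for \<open>inv g \<otimes> h\<close> contributes at most
  \<open>A\<close>; multiplying by \<open>g\<close> costs one more \<open>D\<close>.\<close>

lemma ex_coarsely_lipschitz: "\<exists>A B. coarsely_lipschitz \<phi> A B"
proof -
  \<comment> \<open>The sum dominates \<phi> on all generators at once; the summand 1 makes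
    \<open>A\<close> positive.\<close>
  define A where "A = D + (\<Sum>s\<in>S. \<bar>\<phi> s\<bar>) + 1"
  have D: "D \<ge> \<bar>\<phi> \<one>\<bar>" using quasi[of \<one> \<one>] by simp
  have A: "D + \<bar>\<phi> s\<bar> \<le> A" if "s \<in> S" for s
    using member_le_sum[OF that, of "\<lambda>s. \<bar>\<phi> s\<bar>"] S_finite by (simp add: A_def)
  have word: "\<bar>\<phi> (eval_word ws)\<bar> \<le> A * int (length ws) + D" if "set ws \<subseteq> S" for ws
    using that
  proof (induction ws)
    case (Cons s ws)
    then have "\<bar>\<phi> (s \<otimes> eval_word ws) - \<phi> s - \<phi> (eval_word ws)\<bar> \<le> D"
      using S_carrier by (intro quasi eval_word_closed) auto
    with Cons A[of s] show ?case by (simp add: distrib_left)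
  qed (use D in simp)
  have "\<bar>\<phi> h - \<phi> g\<bar> \<le> A * int (dist_w g h) + 2 * D" if g: "g \<in> carrier G" and h: "h \<in> carrier G" for g h
  proof -
    obtain ws where ws: "set ws \<subseteq> S" "length ws = len (inv g \<otimes> h)" "eval_word ws = inv g \<otimes> h"
      using shortest_word g h by (metis inv_closed m_closed)
    have "g \<otimes> (inv g \<otimes> h) = h" using g h by (simp add: m_assoc[symmetric])
    then have "\<bar>\<phi> h - \<phi> g - \<phi> (inv g \<otimes> h)\<bar> \<le> D" using quasi[of g "inv g \<otimes> h"] g h by simp
    with word[OF ws(1)] ws show ?thesis by (simp add: word_dist_def)
  qed
  moreover have "A > 0" using D by (simp add: A_def sum_nonneg add_nonneg_pos)
  ultimately show ?thesis unfolding coarsely_lipschitz_def by blast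
qed

lemma reach_level:
  assumes "g \<in> carrier G"
  shows "\<exists>h\<in>carrier G. \<phi> h = n \<and> dist_w g h \<le> C * nat \<bar>n - \<phi> g\<bar>"
  using assms
proof (induction "nat \<bar>n - \<phi> g\<bar>" arbitrary: g)
  case 0
  then show ?case by (intro bexI[of _ g]) auto
next
  case (Suc m)
  obtain g' where g': "g' \<in> carrier G" "dist_w g g' \<le> C" "m = nat \<bar>n - \<phi> g'\<bar>"
  proof (cases "\<phi> g < n")
    case True
    then show ?thesis using step_up[OF Suc.prems] Suc.hyps(2) that by fastforce
  next
    case False
    then show ?thesis using step_down[OF Suc.prems] Suc.hyps(2) that by fastforce
  qed
  obtain h where h: "h \<in> carrier G" "\<phi> h = n" "dist_w g' h \<le> C * m"
    using Suc.hyps(1)[OF g'(3,1)] g'(3) by blast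
  then have "dist_w g h \<le> C + C * m" using dist_triangle[of g g' h] Suc.prems g' by simp
  then show ?case using h Suc.hyps(2) by (intro bexI[of _ h]) (auto simp flip: Suc.hyps(2))
qed

text \<open>Each \<open>x k\<close> moves to level \<open>k\<close> within distance
  \<open>C * nat b\<close>, and a bounded displacement keeps the end. Interpolation will start from
  paths that meet every level exactly.\<close>

lemma rising_exact:
  assumes x: "rising \<phi> K b x"
  shows "\<exists>K' x'. rising \<phi> K' 0 x' \<and> gromov_equiv G S `` {x'} = gromov_equiv G S `` {x}"
proof -
  obtain A B where lip: "coarsely_lipschitz \<phi> A B" using ex_coarsely_lipschitz by blast
  have "\<forall>k. \<exists>h. h \<in> carrier G \<and> \<phi> h = int k \<and> dist_w (x k) h \<le> C * nat \<bar>int k - \<phi> (x k)\<bar>"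
    using reach_level[OF risingD(1)[OF x]] by blast
  then obtain x' where x': "\<And>k. x' k \<in> carrier G" "\<And>k. \<phi> (x' k) = int k"
    "\<And>k. dist_w (x k) (x' k) \<le> C * nat \<bar>int k - \<phi> (x k)\<bar>"
    using choice[of "\<lambda>k h. h \<in> carrier G \<and> \<phi> h = int k \<and> dist_w (x k) h \<le> C * nat \<bar>int k - \<phi> (x k)\<bar>"]
    by blast
  have near: "dist_w (x k) (x' k) \<le> C * nat b" for k
  proof -
    have "C * nat \<bar>int k - \<phi> (x k)\<bar> \<le> C * nat b"
      using risingD(3)[OF x, of k] by (intro mult_left_mono nat_mono) auto
    with x'(3)[of k] show ?thesis by linarith
  qed
  have "dist_w (x' k) (x' (Suc k)) \<le> C * nat b + K + C * nat b" for k
  proof -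
    have "dist_w (x' k) (x' (Suc k)) \<le> dist_w (x k) (x' k) + dist_w (x k) (x' (Suc k))"
      using dist_triangle[of "x' k" "x k" "x' (Suc k)"] dist_sym[of "x k" "x' k"] x'(1) risingD(1)[OF x]
      by simp
    moreover have "dist_w (x k) (x' (Suc k)) \<le> dist_w (x k) (x (Suc k)) + dist_w (x (Suc k)) (x' (Suc k))"
      using dist_triangle x'(1) risingD(1)[OF x] by blast
    ultimately show ?thesis using near[of k] near[of "Suc k"] risingD(2)[OF x, of k] by linarith
  qed
  then have rx': "rising \<phi> (C * nat b + K + C * nat b) 0 x'" using x' by (simp add: rising_def)
  from rising_bounded_distance_equiv[OF lip x rx' near] rx' show ?thesis by metis
qed

text \<open>Left multiplication is an isometry, so \<open>K\<close> survives; the quasimorphism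
  bound shifts heights by a bounded amount.\<close>

lemma rising_left_mult:
  assumes g: "g \<in> carrier G" and x: "rising \<phi> K b x"
  shows "rising \<phi> K (D + \<bar>\<phi> g\<bar> + b) (\<lambda>k. g \<otimes> x k)"
  unfolding rising_def
proof (intro allI conjI)
  fix k
  show "g \<otimes> x k \<in> carrier G" "dist_w (g \<otimes> x k) (g \<otimes> x (Suc k)) \<le> K"
    using g risingD[OF x] by (simp_all add: dist_left_mult)
  show "\<bar>\<phi> (g \<otimes> x k) - int k\<bar> \<le> D + \<bar>\<phi> g\<bar> + b"
    using quasi[of g "x k"] g risingD[OF x, of k] by linarith
qed

section \<open>The rising ends as a nonempty invariant subset of the boundary\<close>

lemma rising_ends_subset: "rising_ends \<phi> \<subseteq> gromov_boundary G S"
  using ex_coarsely_lipschitz rising_gromov_sequence gromov_boundary_class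
  unfolding rising_ends_def by blast

lemma rising_ends_nonempty: "rising_ends \<phi> \<noteq> {}"
proof -
  have "\<exists>x. \<forall>k. (x k \<in> carrier G \<and> \<phi> (x k) = int k) \<and> dist_w (x k) (x (Suc k)) \<le> C"
  proof (rule dependent_nat_choice)
    show "\<exists>g. g \<in> carrier G \<and> \<phi> g = int 0" using reach_level[of \<one> 0] by auto
    show "\<exists>h. (h \<in> carrier G \<and> \<phi> h = int (Suc k)) \<and> dist_w g h \<le> C"
      if "g \<in> carrier G \<and> \<phi> g = int k" for g k using step_up[of g] that by force
  qed
  then have "\<exists>x. rising \<phi> C 0 x" unfolding rising_def by auto
  then show ?thesis unfolding rising_ends_def by blast
qed

lemma boundary_act_rising_ends:
  assumes "g \<in> carrier G" shows "boundary_act G g ` rising_ends \<phi> = rising_ends \<phi>"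
proof -
  obtain A B where lip: "coarsely_lipschitz \<phi> A B" using ex_coarsely_lipschitz by blast
  have act: "boundary_act G g (gromov_equiv G S `` {x}) = gromov_equiv G S `` {\<lambda>k. g \<otimes> x k}"
    if "g \<in> carrier G" "rising \<phi> K b x" for g K b x
    using boundary_act_class rising_gromov_sequence[OF lip] that by blast
  have sub: "boundary_act G g \<xi> \<in> rising_ends \<phi>" if g: "g \<in> carrier G" and \<xi>: "\<xi> \<in> rising_ends \<phi>" for g \<xi>
  proof -
    obtain x K b where x: "\<xi> = gromov_equiv G S `` {x}" "rising \<phi> K b x"
      using \<xi> unfolding rising_ends_def by blast
    show ?thesis
      unfolding rising_ends_def x(1) act[OF g x(2)] using rising_left_mult[OF g x(2)] by blast
  qed
  \<comment> \<open>Every end is the image under \<open>g\<close> of its translate by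
    \<open>inv g\<close>; with \<open>sub\<close> for both elements this gives equality.\<close>
  have inv: "boundary_act G g (boundary_act G (inv g) \<xi>) = \<xi>" if \<xi>: "\<xi> \<in> rising_ends \<phi>" for \<xi>
  proof -
    obtain x K b where x: "\<xi> = gromov_equiv G S `` {x}" "rising \<phi> K b x"
      using \<xi> unfolding rising_ends_def by blast
    have "(\<lambda>k. g \<otimes> (inv g \<otimes> x k)) = x"
      using assms risingD[OF x(2)] by (simp add: m_assoc[symmetric])
    then show ?thesis
      using act[OF _ x(2), of "inv g"] act[OF assms rising_left_mult[OF _ x(2)], of "inv g"] x assms by simp
  qed
  show ?thesis using sub[OF assms] sub[of "inv g"] inv assms by (force simp: image_iff)
qed

end

section \<open>Joining two rising sequences\<close>

context uniform_height
begin

lemma level_path: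
  assumes a: "a \<in> carrier G" "\<phi> a = n" and b: "b \<in> carrier G" "\<phi> b = n"
    and m: "dist_w a b \<le> m" "m > 0"
  shows "\<exists>p. p 0 = a \<and> (\<forall>i\<ge>f m. p i = b) \<and>
           (\<forall>i. p i \<in> carrier G \<and> \<phi> (p i) = n \<and> dist_w (p i) (p (Suc i)) \<le> C)"
proof -
  let ?X = "{g \<in> carrier G. \<phi> g = n}"
  obtain x l where x: "is_chain G S C ?X x l" "x 0 = a" "x l = b" "l \<le> f m"
    using level_connected[of n] a b m unfolding Cf_connected_def by blast
  \<comment> \<open>Freezing the chain at its last point replaces its unknown length by the uniform
    bound \<open>f m\<close>.\<close>
  define p where "p = (\<lambda>i. x (min i l))"
  have "p i \<in> carrier G \<and> \<phi> (p i) = n" for i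
    using x(1) unfolding is_chain_def p_def by (auto dest!: spec[of _ "min i l"])
  moreover have "dist_w (p i) (p (Suc i)) \<le> C" for i
  proof (cases "i < l")
    case True
    then show ?thesis using x(1) by (simp add: is_chain_def p_def min_def)
  next
    case False
    then have "p (Suc i) = p i" by (simp add: p_def min_def)
    then show ?thesis using calculation[of i] by simp
  qed
  moreover have "p 0 = a" "\<forall>i\<ge>f m. p i = b" using x by (auto simp: p_def min_absorb2)
  ultimately show ?thesis by blast
qed

text \<open>Resting at \<open>b\<close> past \<open>M\<close> makes every natural number a legal
  index, so parameters beyond 1 need no separate treatment.\<close>

definition level_chain :: "nat \<Rightarrow> 'a \<Rightarrow> 'a \<Rightarrow> nat \<Rightarrow> (nat \<Rightarrow> 'a) \<Rightarrow> bool" where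
  "level_chain k a b M c \<longleftrightarrow> c 0 = a \<and> (\<forall>i\<ge>M. c i = b) \<and>
     (\<forall>i. c i \<in> carrier G \<and> \<phi> (c i) = int k \<and> dist_w (c i) (c (Suc i)) \<le> C)"

text \<open>Pushing a chain up by one level moves neighbours at most \<open>2 * K + C\<close> apart, so uniform
  connectedness joins each such pair by a path with a number of steps that depends on neither the
  chain nor the level.\<close>

lemma refine_level_chain:
  assumes c: "level_chain k a b M c" and M: "M > 0" and K: "C \<le> K"
    and a': "a' \<in> carrier G" "\<phi> a' = int (Suc k)" "dist_w a a' \<le> K"
    and b': "b' \<in> carrier G" "\<phi> b' = int (Suc k)" "dist_w b b' \<le> K"
    and N: "N = Suc (f (Suc (2 * K + C)))"
  shows "\<exists>c'. level_chain (Suc k) a' b' (M * N) c' \<and>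
           (\<forall>q r. r < N \<longrightarrow> dist_w (c q) (c' (N * q + r)) \<le> K + N * C)"
proof -
  note c_simps = c[unfolded level_chain_def]
  \<comment> \<open>The chain is pushed up with prescribed ends; \<open>M > 0\<close> keeps the two
    end conditions compatible.\<close>
  have "\<forall>q. \<exists>h. h \<in> carrier G \<and> \<phi> h = int (Suc k) \<and> dist_w (c q) h \<le> K
      \<and> (q = 0 \<longrightarrow> h = a') \<and> (q \<ge> M \<longrightarrow> h = b')"
  proof
    fix q
    consider "q = 0" | "q \<ge> M" | "0 < q" "q < M" by linarith
    then show "\<exists>h. h \<in> carrier G \<and> \<phi> h = int (Suc k) \<and> dist_w (c q) h \<le> K
      \<and> (q = 0 \<longrightarrow> h = a') \<and> (q \<ge> M \<longrightarrow> h = b')"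
    proof cases
      case 1
      then show ?thesis using a' c_simps M by auto
    next
      case 2
      then show ?thesis using b' c_simps M by auto
    next
      case 3
      then show ?thesis using step_up[of "c q"] c_simps K by force
    qed
  qed
  then obtain u where u: "\<And>q. u q \<in> carrier G" "\<And>q. \<phi> (u q) = int (Suc k)"
    "\<And>q. dist_w (c q) (u q) \<le> K" "u 0 = a'" "\<And>q. q \<ge> M \<Longrightarrow> u q = b'"
    by (metis (no_types))
  have close: "dist_w (u q) (u (Suc q)) \<le> Suc (2 * K + C)" for q
  proof -
    have "dist_w (u q) (u (Suc q)) \<le> dist_w (u q) (c q) + dist_w (c q) (u (Suc q))"
      using u c_simps by (intro dist_triangle) auto
    moreover have "dist_w (c q) (u (Suc q)) \<le> dist_w (c q) (c (Suc q)) + dist_w (c (Suc q)) (u (Suc q))"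
      using u c_simps by (intro dist_triangle) auto
    moreover have "dist_w (u q) (c q) = dist_w (c q) (u q)" using u c_simps by (intro dist_sym) auto
    moreover have "dist_w (c q) (c (Suc q)) \<le> C" using c_simps by blast
    ultimately show ?thesis using u(3)[of q] u(3)[of "Suc q"] by linarith
  qed
  \<comment> \<open>From \<open>M\<close> on the connecting path is constant, since the new chain
    must rest at \<open>b'\<close>. Before that, \<open>N\<close> exceeds the bound of
    \<open>level_path\<close>, so the path has arrived by index \<open>N\<close>.\<close>
  have "\<forall>q. \<exists>p. p 0 = u q \<and> p N = u (Suc q) \<and> (q \<ge> M \<longrightarrow> (\<forall>i. p i = b')) \<and>
      (\<forall>i. p i \<in> carrier G \<and> \<phi> (p i) = int (Suc k) \<and> dist_w (p i) (p (Suc i)) \<le> C)"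
  proof
    fix q
    show "\<exists>p. p 0 = u q \<and> p N = u (Suc q) \<and> (q \<ge> M \<longrightarrow> (\<forall>i. p i = b')) \<and>
      (\<forall>i. p i \<in> carrier G \<and> \<phi> (p i) = int (Suc k) \<and> dist_w (p i) (p (Suc i)) \<le> C)"
    proof (cases "q \<ge> M")
      case True
      then show ?thesis using u(5)[of q] u(5)[of "Suc q"] b' by (intro exI[of _ "\<lambda>_. b'"]) auto
    next
      case False
      then show ?thesis
        using level_path[OF u(1)[of q] u(2)[of q] u(1)[of "Suc q"] u(2)[of "Suc q"] close] N by auto
    qed
  qed
  then obtain p where p: "\<And>q. p q 0 = u q" "\<And>q. p q N = u (Suc q)" "\<And>q i. q \<ge> M \<Longrightarrow> p q i = b'"
    "\<And>q i. p q i \<in> carrier G" "\<And>q i. \<phi> (p q i) = int (Suc k)"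
    "\<And>q i. dist_w (p q i) (p q (Suc i)) \<le> C"
    by metis
  define c' where "c' = (\<lambda>i. p (i div N) (i mod N))"
  have N0: "N > 0" using N by simp
  have "dist_w (c' i) (c' (Suc i)) \<le> C" for i
  proof (cases "Suc (i mod N) = N")
    \<comment> \<open>At the end of a block, \<open>p q N = u (Suc q) = p (Suc q) 0\<close> joins it
      to the next one.\<close>
    case True
    then have "c' (Suc i) = p (i div N) (Suc (i mod N))"
      using p(1,2) by (simp add: c'_def mod_Suc div_Suc)
    then show ?thesis using p(6) by (simp add: c'_def)
  next
    case False
    then show ?thesis using p(6) by (simp add: c'_def mod_Suc div_Suc)
  qed
  moreover have "c' i = b'" if "i \<ge> M * N" for i
  proof -
    have "i div N \<ge> M" using that N0 by (simp add: less_eq_div_iff_mult_less_eq)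
    then show ?thesis using p(3) by (simp add: c'_def)
  qed
  ultimately have "level_chain (Suc k) a' b' (M * N) c'"
    using p u(4) by (simp add: level_chain_def c'_def)
  moreover have "dist_w (c q) (c' (N * q + r)) \<le> K + N * C" if r: "r < N" for q r
  proof -
    have "c' (N * q + r) = p q r" using r by (simp add: c'_def)
    moreover have "dist_w (p q 0) (p q (0 + r)) \<le> C * r" by (rule dist_chain) (rule p)+
    moreover have "C * r \<le> N * C" using mult_le_mono[of C C r N] r by (simp add: mult.commute)
    moreover have "dist_w (c q) (p q r) \<le> dist_w (c q) (p q 0) + dist_w (p q 0) (p q r)"
      using c_simps p(4) by (intro dist_triangle) auto
    ultimately show ?thesis using u(3)[of q] p(1)[of q] by (simp only: add_0)
  qed
  ultimately show ?thesis by blast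
qed

text \<open>The position of a parameter on the finer scale lies in the block of its position on the
  coarser one; this lets a fixed parameter follow one path from level to level.\<close>

lemma nat_floor_mult:
  fixes u :: real and N :: nat
  assumes "u \<ge> 0" "N > 0"
  shows "\<exists>r<N. nat \<lfloor>real N * u\<rfloor> = N * nat \<lfloor>u\<rfloor> + r"
proof -
  define q where "q = nat \<lfloor>u\<rfloor>"
  have q: "real q \<le> u" "u < real q + 1" using assms by (simp_all add: q_def)
  have "real (N * q) \<le> real N * u" using q assms by simp
  then have 1: "N * q \<le> nat \<lfloor>real N * u\<rfloor>" by (rule le_nat_floor)
  have "real N * u < real (N * q + N)"
    using mult_strict_left_mono[OF q(2), of "real N"] assms by (simp add: distrib_left)
  then have 2: "nat \<lfloor>real N * u\<rfloor> < N * q + N" using assms by (simp add: nat_less_iff floor_less_iff)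
  show ?thesis using 1 2 unfolding q_def[symmetric]
    by (intro exI[of _ "nat \<lfloor>real N * u\<rfloor> - N * q"]) linarith
qed

lemma interpolate_rising:
  assumes x: "rising \<phi> K 0 x" and y: "rising \<phi> K 0 y" and K: "C \<le> K"
  shows "\<exists>(X :: real \<Rightarrow> nat \<Rightarrow> 'a) K'. (\<forall>t\<ge>0. rising \<phi> K' 0 (X t)) \<and> X 0 = x \<and> X 1 = y \<and>
    (\<forall>k. \<exists>e>0. \<forall>s\<ge>0. \<forall>t\<ge>0. \<bar>s - t\<bar> < e \<longrightarrow> dist_w (X s k) (X t k) \<le> C)"
proof -
  define N where "N = Suc (f (Suc (2 * K + C)))"
  \<comment> \<open>The inner \<open>Suc\<close> makes the distance bound positive, as
    \<open>level_path\<close> demands; the outer one makes \<open>M\<close> positive.\<close>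
  define M where "M = Suc (f (Suc (dist_w (x 0) (y 0))))"
  have xy: "x k \<in> carrier G" "y k \<in> carrier G" "\<phi> (x k) = int k" "\<phi> (y k) = int k"
    "dist_w (x k) (x (Suc k)) \<le> K" "dist_w (y k) (y (Suc k)) \<le> K" for k
    using risingD[OF x, of k] risingD[OF y, of k] by auto
  have "\<exists>c. \<forall>k. level_chain k (x k) (y k) (M * N ^ k) (c k) \<and>
      (\<forall>q r. r < N \<longrightarrow> dist_w (c k q) (c (Suc k) (N * q + r)) \<le> K + N * C)"
  proof (rule dependent_nat_choice)
    show "\<exists>c. level_chain 0 (x 0) (y 0) (M * N ^ 0) c"
      using level_path[of "x 0" 0 "y 0" "Suc (dist_w (x 0) (y 0))"] xy[of 0]
      unfolding level_chain_def M_def by auto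
    show "\<exists>c'. level_chain (Suc k) (x (Suc k)) (y (Suc k)) (M * N ^ Suc k) c' \<and>
        (\<forall>q r. r < N \<longrightarrow> dist_w (c q) (c' (N * q + r)) \<le> K + N * C)"
      if "level_chain k (x k) (y k) (M * N ^ k) c" for c k
    proof -
      have "M * N ^ k > 0" by (simp add: M_def N_def)
      from refine_level_chain[OF that this K xy(1)[of "Suc k"] xy(3)[of "Suc k"] xy(5)
          xy(2)[of "Suc k"] xy(4)[of "Suc k"] xy(6) N_def]
      show ?thesis by (simp add: ac_simps)
    qed
  qed
  then obtain c where c: "\<And>k. level_chain k (x k) (y k) (M * N ^ k) (c k)"
    and c_Suc: "\<And>k q r. r < N \<Longrightarrow> dist_w (c k q) (c (Suc k) (N * q + r)) \<le> K + N * C"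
    by blast
  have c1: "c k i \<in> carrier G" "\<phi> (c k i) = int k" "dist_w (c k i) (c k (Suc i)) \<le> C"
    "c k 0 = x k" "i \<ge> M * N ^ k \<Longrightarrow> c k i = y k" for k i
    using c[of k] by (auto simp: level_chain_def)
  \<comment> \<open>At level \<open>k\<close> the unit interval is cut into \<open>M * N ^ k\<close>
    equal pieces, and \<open>t\<close> selects the chain point belonging to its piece.\<close>
  define X where "X t k = c k (nat \<lfloor>t * real (M * N ^ k)\<rfloor>)" for t :: real and k
  have "rising \<phi> (K + N * C) 0 (X t)" if "t \<ge> 0" for t
  proof -
    have "dist_w (X t k) (X t (Suc k)) \<le> K + N * C" for k
    proof -
      have "t * real (M * N ^ Suc k) = real N * (t * real (M * N ^ k))" by simp
      moreover have "t * real (M * N ^ k) \<ge> 0" "N > 0" using \<open>t \<ge> 0\<close> by (simp_all add: N_def)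
      ultimately obtain r where "r < N"
        "nat \<lfloor>t * real (M * N ^ Suc k)\<rfloor> = N * nat \<lfloor>t * real (M * N ^ k)\<rfloor> + r"
        using nat_floor_mult[of "t * real (M * N ^ k)" N] by metis
      then show ?thesis using c_Suc[of r k "nat \<lfloor>t * real (M * N ^ k)\<rfloor>"] by (simp only: X_def)
    qed
    then show ?thesis by (simp add: rising_def X_def c1)
  qed
  moreover have "X 0 = x" by (simp add: fun_eq_iff X_def c1)
  moreover have "X 1 = y" by (simp add: fun_eq_iff X_def c1 del: of_nat_mult of_nat_power)
  moreover have "\<exists>e>0. \<forall>s\<ge>0. \<forall>t\<ge>0. \<bar>s - t\<bar> < e \<longrightarrow> dist_w (X s k) (X t k) \<le> C" for k
  proof (intro exI conjI allI impI)
    \<comment> \<open>Parameters closer than the mesh \<open>1 / a\<close> of level \<open>k\<close>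
      have equal or neighbouring indices.\<close>
    define a where "a = real (M * N ^ k)"
    have "M * N ^ k > 0" by (simp add: M_def N_def)
    then have a: "a > 0" unfolding a_def of_nat_0_less_iff .
    show "1 / a > 0" using a by simp
    fix s t :: real assume st: "s \<ge> 0" "t \<ge> 0" "\<bar>s - t\<bar> < 1 / a"
    have "\<bar>s * a - t * a\<bar> = \<bar>s - t\<bar> * a" using a by (simp add: abs_mult flip: left_diff_distrib)
    also have "\<dots> < 1" using st a by (simp add: field_simps)
    finally have "\<bar>\<lfloor>s * a\<rfloor> - \<lfloor>t * a\<rfloor>\<bar> \<le> 1" by linarith
    moreover have "\<lfloor>s * a\<rfloor> \<ge> 0" "\<lfloor>t * a\<rfloor> \<ge> 0" using st a by auto
    ultimately consider "nat \<lfloor>s * a\<rfloor> = nat \<lfloor>t * a\<rfloor>" | "nat \<lfloor>s * a\<rfloor> = Suc (nat \<lfloor>t * a\<rfloor>)"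
      | "nat \<lfloor>t * a\<rfloor> = Suc (nat \<lfloor>s * a\<rfloor>)" by linarith
    then show "dist_w (X s k) (X t k) \<le> C"
      unfolding X_def a_def[symmetric]
      by cases (simp_all add: c1 dist_sym[of "c k (Suc _)"])
  qed
  ultimately show ?thesis by blast
qed

section \<open>Continuity of the path of ends, and the zipper\<close>

lemma mem_boundary_nbhd:
  assumes "x \<in> gromov_sequences G S" "y \<in> gromov_sequences G S"
    and "\<And>i j. i \<ge> k \<Longrightarrow> j \<ge> k \<Longrightarrow> gp \<one> (x i) (y j) \<ge> r"
  shows "gromov_equiv G S `` {y} \<in> boundary_nbhd G S (gromov_equiv G S `` {x}) r"
proof -
  have "eventually (\<lambda>(i, j). ereal r \<le> ereal (gp \<one> (x i) (y j))) (sequentially \<times>\<^sub>F sequentially)"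
    unfolding eventually_prod_sequentially using assms(3) by auto
  then have "ereal r \<le> Liminf (sequentially \<times>\<^sub>F sequentially) (\<lambda>(i, j). ereal (gp \<one> (x i) (y j)))"
    by (intro Liminf_bounded) (simp add: case_prod_beta')
  then show ?thesis
    unfolding boundary_nbhd_def using assms gromov_boundary_class class_self by blast
qed

lemma path_connectedin_rising_ends: "path_connectedin (boundary_topology G S) (rising_ends \<phi>)"
  unfolding path_connectedin
proof (intro conjI ballI)
  show "rising_ends \<phi> \<subseteq> topspace (boundary_topology G S)"
    using rising_ends_subset by (simp add: topspace_boundary_topology)
  obtain A B where lip: "coarsely_lipschitz \<phi> A B" using ex_coarsely_lipschitz by blast
  fix \<xi> \<eta> assume "\<xi> \<in> rising_ends \<phi>" "\<eta> \<in> rising_ends \<phi>"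
  then obtain K1 x K2 y where x: "rising \<phi> K1 0 x" "\<xi> = gromov_equiv G S `` {x}"
    and y: "rising \<phi> K2 0 y" "\<eta> = gromov_equiv G S `` {y}"
    unfolding rising_ends_def using rising_exact by (smt (verit) mem_Collect_eq)
  define K where "K = max C (max K1 K2)"
  have "rising \<phi> K 0 x" "rising \<phi> K 0 y"
    using rising_weaken[OF x(1), of K 0] rising_weaken[OF y(1), of K 0] by (auto simp: K_def)
  then obtain X :: "real \<Rightarrow> nat \<Rightarrow> 'a" and K' where X: "\<And>t. t \<ge> 0 \<Longrightarrow> rising \<phi> K' 0 (X t)"
    and X01: "X 0 = x" "X 1 = y"
    and close: "\<And>k. \<exists>e>0. \<forall>s\<ge>0. \<forall>t\<ge>0. \<bar>s - t\<bar> < e \<longrightarrow> dist_w (X s k) (X t k) \<le> C"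
    using interpolate_rising[of K x y] by (auto simp: K_def)
  define \<gamma> where "\<gamma> t = gromov_equiv G S `` {X t}" for t
  have X_seq: "X t \<in> gromov_sequences G S" if "t \<ge> 0" for t
    using rising_gromov_sequence[OF lip X[OF that]] .
  obtain c R where c: "c > 0" and R: "\<And>x k i j. rising \<phi> K' 0 x \<Longrightarrow> k \<le> i \<Longrightarrow> k \<le> j
      \<Longrightarrow> gp \<one> (x i) (x j) \<ge> c * real k - R"
    using rising_linear_escape[OF lip] by metis
  have near: "\<exists>e>0. \<forall>t\<ge>0. \<bar>s - t\<bar> < e \<longrightarrow> \<gamma> t \<in> boundary_nbhd G S (\<gamma> s) r" if s: "s \<ge> 0" for s r
  proof -
    \<comment> \<open>The level is so high that the products stay above \<open>r\<close> after two
      four-point steps, which cost \<open>2 * \<delta>\<close>, and the gap \<open>C\<close> between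
      the two paths.\<close>
    obtain k where "(r + real C + 2 * \<delta> + R) / c < real k" using reals_Archimedean2 by blast
    then have k: "c * real k - R - real C \<ge> r + 2 * \<delta>" using c by (simp add: field_simps)
    obtain e where e: "e > 0" "\<And>t. t \<ge> 0 \<Longrightarrow> \<bar>s - t\<bar> < e \<Longrightarrow> dist_w (X s k) (X t k) \<le> C"
      using close[of k] s by blast
    have "\<gamma> t \<in> boundary_nbhd G S (\<gamma> s) r" if t: "t \<ge> 0" "\<bar>s - t\<bar> < e" for t
      unfolding \<gamma>_def
    proof (rule mem_boundary_nbhd[OF X_seq[OF s] X_seq[OF t(1)]])
      fix i j assume ij: "i \<ge> k" "j \<ge> k"
      note car = risingD(1)[OF X[OF s]] risingD(1)[OF X[OF t(1)]]
      have 1: "gp \<one> (X s i) (X s k) \<ge> r + 2 * \<delta>" and 2: "gp \<one> (X t k) (X t j) \<ge> r + 2 * \<delta>"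
        and 3: "gp \<one> (X s k) (X s k) \<ge> r + 2 * \<delta> + real C"
        using R[OF X[OF s], of k i k] R[OF X[OF s], of k k k] R[OF X[OF t(1)], of k k j] k ij by linarith+
      have "real (dist_w (X s k) (X t k)) \<le> real C" using e(2)[OF t] by simp
      then have "gp \<one> (X s k) (X t k) \<ge> r + 2 * \<delta>"
        using 3 gp_ge_left[of \<one> "X s k" "X t k"] car by (simp add: gromov_product_def[of G S \<one> "X s k" "X s k"])
      then have "gp \<one> (X s i) (X t k) \<ge> r + 2 * \<delta> - \<delta>"
        using four_point_ge[OF _ _ _ _ 1] car by simp
      then show "gp \<one> (X s i) (X t j) \<ge> r"
        using four_point_ge[of \<one> "X s i" "X t k" "X t j" "r + \<delta>"] 2 car delta_nonneg by simp
    qed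
    with e(1) show ?thesis by blast
  qed
  have "pathin (boundary_topology G S) \<gamma>"
    unfolding pathin_def continuous_map_def topspace_boundary_topology
  proof (intro conjI allI impI)
    show "\<gamma> \<in> topspace (top_of_set {0..1}) \<rightarrow> gromov_boundary G S"
      using X_seq gromov_boundary_class by (auto simp: \<gamma>_def)
    fix U assume U: "openin (boundary_topology G S) U"
    show "openin (top_of_set {0..1}) {t \<in> topspace (top_of_set {0..1}). \<gamma> t \<in> U}"
      unfolding openin_euclidean_subtopology_iff
    proof (intro conjI ballI)
      fix s assume "s \<in> {t \<in> topspace (top_of_set {0..1}). \<gamma> t \<in> U}"
      then have s: "s \<ge> 0" "\<gamma> s \<in> U" by auto
      \<comment> \<open>An open set contains some \<open>boundary_nbhd\<close> of each of its
        points, so \<open>near\<close> suffices whether or not these neighbourhoods are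
        open.\<close>
      obtain r where "boundary_nbhd G S (\<gamma> s) r \<subseteq> U"
        using U s(2) unfolding openin_boundary_topology by blast
      with near[OF s(1), of r]
      show "\<exists>e>0. \<forall>t\<in>{0..1}. dist t s < e \<longrightarrow> t \<in> {t \<in> topspace (top_of_set {0..1}). \<gamma> t \<in> U}"
        by (force simp: dist_real_def abs_minus_commute)
    qed auto
  qed
  moreover have "\<gamma> \<in> {0..1} \<rightarrow> rising_ends \<phi>" using X unfolding \<gamma>_def rising_ends_def by fastforce
  moreover have "\<gamma> 0 = \<xi>" "\<gamma> 1 = \<eta>" using x y by (simp_all add: \<gamma>_def X01)
  ultimately show "\<exists>g. pathin (boundary_topology G S) g \<and> g \<in> {0..1} \<rightarrow> rising_ends \<phi> \<and> g 0 = \<xi> \<and> g 1 = \<eta>"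
    by blast
qed

lemma rising_ends_disjoint: "rising_ends \<phi> \<inter> rising_ends (\<lambda>g. - \<phi> g) = {}"
proof (rule ccontr)
  assume "rising_ends \<phi> \<inter> rising_ends (\<lambda>g. - \<phi> g) \<noteq> {}"
  then obtain x K b y K' b' where x: "rising \<phi> K b x" and y: "rising (\<lambda>g. - \<phi> g) K' b' y"
    and eq: "gromov_equiv G S `` {x} = gromov_equiv G S `` {y}"
    unfolding rising_ends_def by blast
  obtain A B where lip: "coarsely_lipschitz \<phi> A B" using ex_coarsely_lipschitz by blast
  then have "coarsely_lipschitz (\<lambda>g. - \<phi> g) A B"
    by (auto simp: coarsely_lipschitz_def abs_minus_commute)
  then have "(x, y) \<in> gromov_equiv G S"
    using rising_gromov_sequence[OF lip x] rising_gromov_sequence[OF _ y] eq class_eq_iff by blast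
  \<comment> \<open>The separation lemma takes the same constants for both paths, hence the
    maxima.\<close>
  with rising_falling_not_equiv[OF lip rising_weaken[OF x] rising_weaken[OF y],
      of "max K K'" "max b b'"] show False by simp
qed

lemma zipper_rising_ends: "zipper G S (rising_ends \<phi>) (rising_ends (\<lambda>g. - \<phi> g))"
proof -
  interpret neg: uniform_height G S \<delta> "\<lambda>g. - \<phi> g" D C f by (rule uniform_height_uminus)
  show ?thesis
    unfolding zipper_def
    using rising_ends_subset neg.rising_ends_subset rising_ends_nonempty neg.rising_ends_nonempty
      path_connectedin_rising_ends neg.path_connectedin_rising_ends rising_ends_disjoint
      boundary_act_rising_ends neg.boundary_act_rising_ends
    by simp
qed

end

theorem mainTheorem3:
  fixes G :: "('a, 'b) monoid_scheme" and S :: "'a set"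
  assumes "hyperbolic_group G S"
    and "\<exists>\<phi>. uniform_quasimorphism G S \<phi>"
  shows "\<exists>Zp Zm. zipper G S Zp Zm"
proof -
  obtain \<phi> C f where uni: "Cf_uniform G S C f \<phi>"
    using assms(2) unfolding uniform_quasimorphism_def by blast
  obtain \<delta> where hyp: "group G" "finite_symmetric_generating_set G S" "\<delta> \<ge> 0"
    "\<And>p x y z. \<lbrakk>p \<in> carrier G; x \<in> carrier G; y \<in> carrier G; z \<in> carrier G\<rbrakk>
      \<Longrightarrow> gromov_product G S p x z
          \<ge> min (gromov_product G S p x y) (gromov_product G S p y z) - \<delta>"
    using assms(1) unfolding hyperbolic_group_def by blast
  obtain D' where D': "\<And>g h. g \<in> carrier G \<Longrightarrow> h \<in> carrier G \<Longrightarrow>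
      \<bar>real_of_int (\<phi> (g \<otimes>\<^bsub>G\<^esub> h)) - real_of_int (\<phi> g) - real_of_int (\<phi> h)\<bar> \<le> D'"
    using uni unfolding Cf_uniform_def quasimorphism_def by blast
  \<comment> \<open>The quantity to be bounded is an integer, so a real bound may be replaced by its
    floor.\<close>
  define D where "D = \<lfloor>D'\<rfloor>"
  have quasi: "\<bar>\<phi> (g \<otimes>\<^bsub>G\<^esub> h) - \<phi> g - \<phi> h\<bar> \<le> D" if "g \<in> carrier G" "h \<in> carrier G" for g h
    using D'[OF that] unfolding D_def le_floor_iff by simp
  have steps: "\<exists>h\<in>carrier G. word_dist G S g h \<le> C \<and> \<phi> h = \<phi> g + 1"
    "\<exists>h\<in>carrier G. word_dist G S g h \<le> C \<and> \<phi> h = \<phi> g - 1" if "g \<in> carrier G" for g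
  proof -
    have "\<exists>hp\<in>carrier G. \<exists>hm\<in>carrier G. word_dist G S g hp \<le> C \<and> word_dist G S g hm \<le> C \<and>
        \<phi> hp - \<phi> g = 1 \<and> \<phi> hm - \<phi> g = - 1"
      using uni that unfolding Cf_uniform_def by (elim conjE) (erule bspec)
    then show "\<exists>h\<in>carrier G. word_dist G S g h \<le> C \<and> \<phi> h = \<phi> g + 1"
      "\<exists>h\<in>carrier G. word_dist G S g h \<le> C \<and> \<phi> h = \<phi> g - 1" by force+
  qed
  have levels: "Cf_connected G S C f {g \<in> carrier G. \<phi> g = n}" for n
    using uni unfolding Cf_uniform_def by (elim conjE) (erule spec)
  interpret uniform_height G S \<delta> \<phi> D C f
  proof (intro uniform_height.intro hyperbolic.intro word_metric.intro
      uniform_height_axioms.intro hyperbolic_axioms.intro word_metric_axioms.intro)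
    show "Cf_connected G S C f {g \<in> carrier G. \<phi> g = n}" for n by (rule levels)
  qed (fact hyp quasi steps)+
  show ?thesis using zipper_rising_ends by blast
qed

end
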